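(* For $n\ge 2$ let $g(n)$ denote the maximum size $m$ of an $(n,n)$-bounded 1-cross intersecting set pair system $(\mathcal{A},\mathcal{B})$ such that $\mathcal{A}$ is 1-intersecting. Then $g(n)\ge n^2-o(n^2)$ as $n\to\infty$.
   Context: A cross intersecting set pair system (SPS) of size $m\ge 2$ consists of finite sets $A_1,\dots,A_m$ and $B_1,\dots,B_m$ such that $A_i\cap B_i=\emptyset$ for every $1\le i\le m$ and $A_i\cap B_j\neq\emptyset$ for all $1\le i\neq j\le m$; one writes $\mathcal{A}=\{A_i\}_{i=1}^m$, $\mathcal{B}=\{B_i\}_{i=1}^m$. It is $(a,b)$-bounded if $|A_i|\le a$ and $|B_i|\le b$ for each $i$. It is 1-cross intersecting if $|A_i\cap B_j|=1$ for each $i\neq j$. $\mathcal{A}$ is 1-intersecting if $|A_i\cap A_j|=1$ for all $i\ne j$. No condition is imposed on $|B_i\cap B_j|$ for $i\neq j$. *)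

theory Defs
  imports Complex_Main "HOL-Library.Landau_Symbols"
begin

definition set_pair_system :: "nat \<Rightarrow> (nat \<Rightarrow> 'a set) \<Rightarrow> (nat \<Rightarrow> 'a set) \<Rightarrow> bool" where
  "set_pair_system m A B \<longleftrightarrow>
     m \<ge> 2 \<and>
     (\<forall>i\<in>{1..m}. finite (A i) \<and> finite (B i)) \<and>
     (\<forall>i\<in>{1..m}. A i \<inter> B i = {}) \<and>
     (\<forall>i\<in>{1..m}. \<forall>j\<in>{1..m}. i \<noteq> j \<longrightarrow> A i \<inter> B j \<noteq> {})"

definition bounded_pair :: "nat \<Rightarrow> nat \<Rightarrow> nat \<Rightarrow> (nat \<Rightarrow> 'a set) \<Rightarrow> (nat \<Rightarrow> 'a set) \<Rightarrow> bool" where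
  "bounded_pair a b m A B \<longleftrightarrow> (\<forall>i\<in>{1..m}. card (A i) \<le> a \<and> card (B i) \<le> b)"

definition one_cross_intersecting :: "nat \<Rightarrow> (nat \<Rightarrow> 'a set) \<Rightarrow> (nat \<Rightarrow> 'a set) \<Rightarrow> bool" where
  "one_cross_intersecting m A B \<longleftrightarrow>
     (\<forall>i\<in>{1..m}. \<forall>j\<in>{1..m}. i \<noteq> j \<longrightarrow> card (A i \<inter> B j) = 1)"

definition one_intersecting :: "nat \<Rightarrow> (nat \<Rightarrow> 'a set) \<Rightarrow> bool" where
  "one_intersecting m A \<longleftrightarrow>
     (\<forall>i\<in>{1..m}. \<forall>j\<in>{1..m}. i \<noteq> j \<longrightarrow> card (A i \<inter> A j) = 1)"

definition admissible :: "nat \<Rightarrow> nat \<Rightarrow> (nat \<Rightarrow> 'a set) \<Rightarrow> (nat \<Rightarrow> 'a set) \<Rightarrow> bool" where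
  "admissible n m A B \<longleftrightarrow>
     set_pair_system m A B \<and> bounded_pair n n m A B \<and>
     one_cross_intersecting m A B \<and> one_intersecting m A"

text \<open>
  The ground set is taken inside \<^typ>\<open>nat\<close>. This loses no systems, since only finitely many
  finite sets are involved; see \<open>admissible_size\<close> below.
\<close>

definition admissible_sizes :: "nat \<Rightarrow> nat set" where
  "admissible_sizes n = {m. \<exists>A B :: nat \<Rightarrow> nat set. admissible n m A B}"

text \<open>
  \<^const>\<open>Max\<close> is meaningful only for finite nonempty sets; \<open>finite_admissible_sizes\<close> and
  \<open>admissible_sizes_nonempty\<close> below show that this is the case for \<open>n \<ge> 2\<close>.
\<close>

definition g :: "nat \<Rightarrow> nat" where
  "g n = Max (admissible_sizes n)"

lemma admissible_size:
  fixes A B :: "nat \<Rightarrow> 'a set"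
  assumes adm: "admissible n m A B"
  shows "m \<in> admissible_sizes n"
proof -
  define U where "U = (\<Union>i\<in>{1..m}. A i \<union> B i)"
  have fin: "finite U"
    using adm by (auto simp: U_def admissible_def set_pair_system_def)
  obtain f :: "'a \<Rightarrow> nat" where f: "inj_on f U"
    using finite_imp_inj_to_nat_seg[OF fin] by blast
  have sub: "A i \<subseteq> U" "B i \<subseteq> U" if "i \<in> {1..m}" for i
    using that by (auto simp: U_def)
  have int: "f ` X \<inter> f ` Y = f ` (X \<inter> Y)" if "X \<subseteq> U" "Y \<subseteq> U" for X Y
    using inj_on_image_Int[OF f that] by simp
  have crd: "card (f ` X) = card X" if "X \<subseteq> U" for X
    using f that by (meson card_image inj_on_subset)
  have crdi: "card (f ` X \<inter> f ` Y) = card (X \<inter> Y)" if "X \<subseteq> U" "Y \<subseteq> U" for X Y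
    unfolding int[OF that] using that by (intro crd) auto
  have disj: "f ` X \<inter> f ` Y = {} \<longleftrightarrow> X \<inter> Y = {}" if "X \<subseteq> U" "Y \<subseteq> U" for X Y
    by (simp add: int[OF that])
  have "admissible n m (\<lambda>i. f ` A i) (\<lambda>i. f ` B i)"
    using adm sub
    unfolding admissible_def set_pair_system_def bounded_pair_def
      one_cross_intersecting_def one_intersecting_def
    by (simp add: disj crd crdi)
  then show ?thesis
    unfolding admissible_sizes_def by blast
qed

lemma cross_intersecting_card_le:
  fixes A B :: "'i \<Rightarrow> 'a set"
  assumes "finite I"
    and "\<And>i. i \<in> I \<Longrightarrow> finite (A i) \<and> finite (B i) \<and> card (A i) \<le> a \<and> card (B i) \<le> b"
    and "\<And>i. i \<in> I \<Longrightarrow> A i \<inter> B i = {}"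
    and "\<And>i j. i \<in> I \<Longrightarrow> j \<in> I \<Longrightarrow> i \<noteq> j \<Longrightarrow> A i \<inter> B j \<noteq> {}"
  shows "card I \<le> (b + 1) ^ a"
  using assms
proof (induction a arbitrary: I A)
  case 0
  have "i = j" if "i \<in> I" "j \<in> I" for i j
    using 0(2)[OF that(1)] 0(4)[OF that] by (cases "i = j") auto
  then show ?case
    using 0(1) by (simp add: card_le_Suc0_iff_eq)
next
  case (Suc a)
  show ?case
  proof (cases "I = {}")
    case False
    then obtain k where k: "k \<in> I" by blast
    define J where "J x = {i \<in> I. x \<in> A i}" for x
    have J: "card (J x) \<le> (b + 1) ^ a" for x
    proof (rule Suc.IH[of "J x" "\<lambda>i. A i - {x}"])
      show "finite (J x)" using Suc.prems(1) by (simp add: J_def)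
    next
      fix i assume "i \<in> J x"
      then show "finite (A i - {x}) \<and> finite (B i) \<and> card (A i - {x}) \<le> a \<and> card (B i) \<le> b"
        using Suc.prems(2)[of i] by (auto simp: J_def)
    next
      fix i assume "i \<in> J x"
      then show "(A i - {x}) \<inter> B i = {}"
        using Suc.prems(3)[of i] by (auto simp: J_def)
    next
      fix i j assume "i \<in> J x" "j \<in> J x" "i \<noteq> j"
      then show "(A i - {x}) \<inter> B j \<noteq> {}"
        using Suc.prems(3)[of j] Suc.prems(4)[of i j] by (auto simp: J_def)
    qed
    have finB: "finite (B k)" and cB: "card (B k) \<le> b"
      using Suc.prems(2)[OF k] by auto
    have finJ: "finite (J x)" for x
      using Suc.prems(1) by (simp add: J_def)
    have sub: "I \<subseteq> insert k (\<Union>x\<in>B k. J x)"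
      using Suc.prems(4) k by (fastforce simp: J_def)
    have "card I \<le> card (insert k (\<Union>x\<in>B k. J x))"
      using sub finB finJ by (intro card_mono) auto
    also have "\<dots> \<le> Suc (card (\<Union>x\<in>B k. J x))"
      by (rule card_insert_le_m1) auto
    also have "card (\<Union>x\<in>B k. J x) \<le> (\<Sum>x\<in>B k. card (J x))"
      using finB by (rule card_UN_le)
    also have "\<dots> \<le> card (B k) * (b + 1) ^ a"
      using sum_bounded_above[of "B k" "\<lambda>x. card (J x)" "(b + 1) ^ a"] J by simp
    also have "\<dots> \<le> b * (b + 1) ^ a"
      using cB by simp
    also have "Suc (b * (b + 1) ^ a) \<le> (b + 1) ^ Suc a"
      by simp
    finally show ?thesis by simp
  qed simp
qed

lemma finite_admissible_sizes: "finite (admissible_sizes n)"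
proof -
  have "m \<le> (n + 1) ^ n" if "m \<in> admissible_sizes n" for m
  proof -
    obtain A B :: "nat \<Rightarrow> nat set" where "admissible n m A B"
      using \<open>m \<in> admissible_sizes n\<close> unfolding admissible_sizes_def by blast
    then have "card {1..m} \<le> (n + 1) ^ n"
      by (intro cross_intersecting_card_le[of _ A B])
        (auto simp: admissible_def set_pair_system_def bounded_pair_def)
    then show ?thesis by simp
  qed
  then show ?thesis
    by (meson atMost_iff finite_atMost finite_subset subsetI)
qed

lemma admissible_sizes_nonempty:
  assumes "n \<ge> 2"
  shows "admissible_sizes n \<noteq> {}"
proof -
  define A :: "nat \<Rightarrow> nat set" where "A i = {0, i}" for i
  define B :: "nat \<Rightarrow> nat set" where "B i = {3 - i}" for i
  have two: "{1..2} = {1, 2 :: nat}" by auto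
  have neq: "3 - i \<noteq> i" for i :: nat
    by presburger
  have "admissible n 2 A B"
    using assms neq
    by (auto simp: admissible_def set_pair_system_def bounded_pair_def
        one_cross_intersecting_def one_intersecting_def two A_def B_def)
  then show ?thesis
    unfolding admissible_sizes_def by blast
qed

end

theory Submission
  imports
    Defs
    "HOL-Complex_Analysis.Complex_Analysis"
    "HOL-Number_Theory.Cong"
    "HOL-Number_Theory.Prime_Powers"
    "HOL-Real_Asymp.Real_Asymp"
begin

text \<open>
  The starting point is the plane over the field with \<open>q\<close> elements, \<open>q\<close> prime. For the lines
  \<open>y = a (x - r)\<close> with \<open>a \<noteq> 0\<close>, including their points at infinity, two distinct ones always share
  exactly one point, and there are \<open>q (q - 1)\<close> of them, each with \<open>q + 1\<close> points. The column \<open>x = r\<close>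
  without \<open>(r, 0)\<close> meets each line exactly once, except for the \<open>q - 1\<close> lines through \<open>(r, 0)\<close>, which
  it misses. So it is almost the partner \<open>B\<close> of each of these lines; what remains is to tell the
  lines through \<open>(r, 0)\<close> apart. For this, the point \<open>(r, 0)\<close> is replaced by a fresh copy of a
  system with the required properties and \<open>q - 1\<close> members: line \<open>a\<close> receives the set \<open>C a\<close> in place
  of the point, and its column the set \<open>D a\<close>. If the inner sets have at most \<open>k\<close> elements, the new system
  is \<open>(q + k, q + k)\<close>-bounded (\<open>cross_system_lines\<close>). An inner system with \<open>k\<close> of
  order \<open>sqrt q\<close> is obtained by the same construction for a smaller prime \<open>p\<close>, starting from a
  trivial system. Hence \<open>g n \<ge> q (q - 1)\<close> as soon as \<open>q + 2 p + 2 \<le> n\<close> for primes with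
  \<open>q \<le> p (p - 1)\<close> (\<open>prime_system_size\<close>).

  To let \<open>q\<close> be asymptotically equal to an arbitrary \<open>n\<close>, a prime is needed between \<open>a x\<close> and \<open>b x\<close>
  for every \<open>0 < a < b\<close> and all large \<open>x\<close> (\<open>eventually_prime_between\<close>). This has the depth of the prime number
  theorem and is proved by a form of the Wiener-Ikehara argument. Since zeta has no zeros with real part at
  least 1, the difference of the Dirichlet series of the von Mangoldt function and of the constant 1
  extends holomorphically across the line \<open>Re s = 1\<close>. Integrating it over a bounded segment of that line
  against a triangle times \<open>exp (- i T t)\<close> compares the primes near \<open>exp T\<close> with the integers near
  \<open>exp T\<close>, both weighted by a Fejer kernel in the logarithm, and by the Riemann-Lebesgue lemma the
  difference tends to 0 as \<open>T\<close> grows. A gap of fixed logarithmic length in the primes would make the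
  first weighted sum smaller than the second by a fixed amount once the kernel is narrow enough.
\<close>

section \<open>Systems of lines over a prime field\<close>

definition cross_system :: "'i set \<Rightarrow> nat \<Rightarrow> nat \<Rightarrow> ('i \<Rightarrow> 'a set) \<Rightarrow> ('i \<Rightarrow> 'a set) \<Rightarrow> bool" where
  "cross_system I a b A B \<longleftrightarrow>
     (\<forall>i\<in>I. finite (A i) \<and> finite (B i) \<and> card (A i) \<le> a \<and> card (B i) \<le> b \<and> A i \<inter> B i = {}) \<and>
     (\<forall>i\<in>I. \<forall>j\<in>I. i \<noteq> j \<longrightarrow> card (A i \<inter> B j) = 1 \<and> card (A i \<inter> A j) = 1)"

lemma cross_system_reindex:
  assumes "cross_system J a b A B" "inj_on f I" "f ` I \<subseteq> J"
  shows "cross_system I a b (A \<circ> f) (B \<circ> f)"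
  using assms unfolding cross_system_def inj_on_def image_subset_iff o_def by metis

lemma cross_system_mono:
  assumes "cross_system I a b A B" "a \<le> a'" "b \<le> b'"
  shows "cross_system I a' b' A B"
  using assms unfolding cross_system_def by (meson order.trans)

lemma cross_system_imp_admissible_size:
  assumes "cross_system I n n A B" "finite I" "card I \<ge> 2"
  shows "card I \<in> admissible_sizes n"
proof -
  obtain f where "bij_betw f {1..card I} I"
    using assms(2) ex_bij_betw_nat_finite_1 by blast
  then have "cross_system {1..card I} n n (A \<circ> f) (B \<circ> f)"
    using assms(1) by (intro cross_system_reindex) (auto simp: bij_betw_def)
  then have "admissible n (card I) (A \<circ> f) (B \<circ> f)"
    using assms(3)
    unfolding cross_system_def admissible_def set_pair_system_def bounded_pair_def
      one_cross_intersecting_def one_intersecting_def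
    by (auto simp del: One_nat_def) (metis atLeastAtMost_iff card.empty zero_neq_one)
  then show ?thesis by (rule admissible_size)
qed

text \<open>
  Small on one side only: the sets \<open>{0, i}\<close> are short, but their partners are as large as the
  family. It seeds the construction below.
\<close>

lemma cross_system_star: "cross_system {1..<N} 2 N (\<lambda>i. {0, i}) (\<lambda>i. {1..<N} - {i})"
proof -
  have "card {0, i} \<le> 2" for i :: nat by (simp add: card_insert_if)
  moreover have "card ({1..<N} - {i}) \<le> N" for i
    using card_mono[of "{1..<N}" "{1..<N} - {i}"] by simp
  moreover have "{0, i} \<inter> ({1..<N} - {j}) = {i}" if "i \<in> {1..<N}" "i \<noteq> j" for i j using that by auto
  moreover have "{0, i} \<inter> {0, j} = {0}" if "i \<noteq> j" for i j :: nat using that by auto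
  ultimately show ?thesis by (auto simp: cross_system_def)
qed

text \<open>
  \<open>Affine x y\<close> is the point \<open>(x, y)\<close> of the plane over \<open>\<int>/q\<close>, \<open>Slope a\<close> is the point at infinity of
  the lines of slope \<open>a\<close>, and \<open>Aux r c\<close> is the element \<open>c\<close> of the copy of the inner system that
  replaces the point \<open>(r, 0)\<close>.
\<close>

datatype 'a point = Affine nat int | Slope nat | Aux nat 'a

definition line_value :: "nat \<Rightarrow> nat \<times> nat \<Rightarrow> nat \<Rightarrow> int" where
  "line_value q = (\<lambda>(a, r) x. (int a * (int x - int r)) mod int q)"

text \<open>
  The line \<open>y = a (x - r)\<close> with its point at infinity, where its zero \<open>(r, 0)\<close> is replaced by the
  inner set \<open>C a\<close>. The column \<open>x = r\<close> meets every line of a different zero in one point other than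
  \<open>(r, 0)\<close>; among the lines with zero \<open>r\<close> only the inner partner \<open>D a\<close> decides.
\<close>

definition line_set :: "nat \<Rightarrow> (nat \<Rightarrow> 'a set) \<Rightarrow> nat \<times> nat \<Rightarrow> 'a point set" where
  "line_set q C = (\<lambda>(a, r). (\<lambda>x. Affine x (line_value q (a, r) x)) ` ({..<q} - {r}) \<union> {Slope a} \<union> Aux r ` C a)"

definition column_set :: "nat \<Rightarrow> (nat \<Rightarrow> 'a set) \<Rightarrow> nat \<times> nat \<Rightarrow> 'a point set" where
  "column_set q D = (\<lambda>(a, r). Affine r ` {1..<int q} \<union> Aux r ` D a)"

lemma not_dvd_diff:
  assumes "x < q" "y < q" "x \<noteq> y"
  shows "\<not> int q dvd int x - int y"
proof
  assume "int q dvd int x - int y"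
  then have "[int x = int y] (mod int q)" by (simp add: cong_iff_dvd_diff)
  then have "[x = y] (mod q)" by (simp add: cong_int_iff)
  then show False using assms by (simp add: cong_def)
qed

lemma line_value_eq_iff:
  "line_value q (a, r) x = line_value q (a', r') x
    \<longleftrightarrow> int q dvd int a * (int x - int r) - int a' * (int x - int r')"
  by (simp add: line_value_def mod_eq_dvd_iff)

lemma line_value_range:
  assumes q: "prime q" and a: "a \<in> {1..<q}" and x: "x < q" "r < q" "x \<noteq> r"
  shows "line_value q (a, r) x \<in> {1..<int q}"
proof -
  have q0: "int q > 0" using q prime_gt_0_nat by simp
  have "prime (int q)" using q by simp
  moreover have "\<not> int q dvd int a" using a by (auto dest: dvd_imp_le)
  ultimately have "\<not> int q dvd int a * (int x - int r)"
    using not_dvd_diff[of x q r] x by (simp add: prime_dvd_mult_iff)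
  then have "line_value q (a, r) x \<noteq> 0" by (simp add: line_value_def dvd_eq_mod_eq_0)
  moreover have "0 \<le> line_value q (a, r) x" "line_value q (a, r) x < int q"
    using q0 by (simp_all add: line_value_def)
  ultimately show ?thesis by simp
qed

text \<open>
  Equality of the two values is one linear congruence in \<open>x\<close> with leading coefficient \<open>a - a'\<close>, a
  unit modulo the prime \<open>q\<close>.
\<close>

lemma lines_meet_once:
  assumes q: "prime q" and a: "a < q" "a' < q" "a \<noteq> a'"
  shows "\<exists>!x. x < q \<and> line_value q (a, r) x = line_value q (a', r') x"
proof -
  let ?d = "int a - int a'" and ?c = "int a * int r - int a' * int r'"
  have iff: "line_value q (a, r) x = line_value q (a', r') x \<longleftrightarrow> int q dvd ?d * int x - ?c" for x
    unfolding line_value_eq_iff by (simp add: algebra_simps)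
  have pq: "prime (int q)" using q by simp
  have nd: "\<not> int q dvd ?d" using a by (intro not_dvd_diff)
  then have "coprime ?d (int q)" using pq by (simp add: coprime_commute prime_imp_coprime)
  then obtain u where u: "[?d * u = 1] (mod int q)" using cong_solve_coprime_int by blast
  define x where "x = nat ((u * ?c) mod int q)"
  have q0: "int q > 0" using q prime_gt_0_nat by simp
  then have x: "int x = (u * ?c) mod int q" by (simp add: x_def)
  have "x < q" using q0 x by (metis of_nat_less_iff pos_mod_bound)
  have "[?d * int x = ?d * (u * ?c)] (mod int q)"
    unfolding x by (intro cong_mult cong_refl) (simp add: cong_def)
  also have "?d * (u * ?c) = (?d * u) * ?c" by simp
  also have "[(?d * u) * ?c = 1 * ?c] (mod int q)" by (intro cong_mult cong_refl u)
  finally have "int q dvd ?d * int x - ?c" by (simp add: cong_iff_dvd_diff)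
  show ?thesis
  proof (rule ex1I[of _ x])
    show "x < q \<and> line_value q (a, r) x = line_value q (a', r') x"
      using iff \<open>x < q\<close> \<open>int q dvd ?d * int x - ?c\<close> by blast
    fix y assume y: "y < q \<and> line_value q (a, r) y = line_value q (a', r') y"
    then have "int q dvd (?d * int y - ?c) - (?d * int x - ?c)"
      using iff \<open>int q dvd ?d * int x - ?c\<close> by (meson dvd_diff)
    then have "int q dvd ?d * (int y - int x)" by (simp add: algebra_simps)
    then have "int q dvd int y - int x" using pq nd by (simp add: prime_dvd_mult_iff)
    then show "y = x" using not_dvd_diff[of y q x] y \<open>x < q\<close> by blast
  qed
qed

lemma card_Aux_image [simp]: "card (Aux r ` X) = card X"
  by (intro card_image) (simp add: inj_on_def)

lemma line_column_disjoint:
  assumes "C a \<inter> D a = {}"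
  shows "line_set q C (a, r) \<inter> column_set q D (a, r) = {}"
  using assms by (auto simp: line_set_def column_set_def)

text \<open>
  Lines with the same zero differ in slope and meet the column only inside the copy of the inner
  system; a line with another zero crosses the column once, away from the removed point.
\<close>

lemma line_column_meet:
  assumes q: "prime q" and i: "a \<in> {1..<q}" "r < q" and j: "r' < q"
    and ne: "(a, r) \<noteq> (a', r')" and C: "a \<noteq> a' \<Longrightarrow> card (C a \<inter> D a') = 1"
  shows "card (line_set q C (a, r) \<inter> column_set q D (a', r')) = 1"
proof (cases "r = r'")
  case True
  then have "line_set q C (a, r) \<inter> column_set q D (a', r') = Aux r ` (C a \<inter> D a')"
    by (auto simp: line_set_def column_set_def)
  then show ?thesis using C ne True by simp
next
  case False
  then have "line_set q C (a, r) \<inter> column_set q D (a', r') = {Affine r' (line_value q (a, r) r')}"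
    using line_value_range[OF q i(1) j i(2)] j by (auto simp: line_set_def column_set_def)
  then show ?thesis by simp
qed

text \<open>
  Three cases: lines with a common zero met in the point that was replaced, so now they meet in the
  inner system; parallel lines meet at infinity; all other pairs meet in the affine plane, and not in
  a removed point because the values there are nonzero.
\<close>

lemma line_line_meet:
  fixes C :: "nat \<Rightarrow> 'a set"
  assumes q: "prime q" and i: "a \<in> {1..<q}" "r < q" and j: "a' \<in> {1..<q}" "r' < q"
    and ne: "(a, r) \<noteq> (a', r')" and C: "a \<noteq> a' \<Longrightarrow> card (C a \<inter> C a') = 1"
  shows "card (line_set q C (a, r) \<inter> line_set q C (a', r')) = 1"
proof -
  have z: "line_value q (b, s) s = 0" for b s by (simp add: line_value_def)
  have nz: "line_value q (b, s) x \<noteq> 0" if "b \<in> {1..<q}" "x < q" "s < q" "x \<noteq> s" for b s x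
    using line_value_range[OF q that] by auto
  consider "r = r'" "a \<noteq> a'" | "r \<noteq> r'" "a = a'" | "r \<noteq> r'" "a \<noteq> a'" using ne by auto
  then show ?thesis
  proof cases
    case 1
    have "line_value q (a, r) x \<noteq> line_value q (a', r) x" if "x < q" "x \<noteq> r" for x
      using lines_meet_once[OF q, of a a' r r] 1 i j that z by (metis atLeastLessThan_iff)
    then have "line_set q C (a, r) \<inter> line_set q C (a', r') = Aux r ` (C a \<inter> C a')"
      using 1 by (auto simp: line_set_def)
    then show ?thesis using C 1 by simp
  next
    case 2
    have "line_value q (a, r) x \<noteq> line_value q (a, r') x" for x
    proof
      assume "line_value q (a, r) x = line_value q (a, r') x"
      then have "int q dvd int a * (int r' - int r)"
        unfolding line_value_eq_iff by (simp add: algebra_simps)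
      then have "line_value q (a, r) r' = 0" by (simp add: line_value_def)
      then show False using nz[of a r' r] i j 2 by simp
    qed
    then have "line_set q C (a, r) \<inter> line_set q C (a', r') = {Slope a}"
      using 2 by (auto simp: line_set_def)
    then show ?thesis by simp
  next
    case 3
    then have "\<exists>!x. x < q \<and> line_value q (a, r) x = line_value q (a', r') x"
      using i j by (intro lines_meet_once[OF q]) auto
    then obtain x where x: "x < q" "line_value q (a, r) x = line_value q (a', r') x"
      and uniq: "\<forall>y. y < q \<and> line_value q (a, r) y = line_value q (a', r') y \<longrightarrow> y = x"
      by (elim ex1E) blast
    have "x \<noteq> r" "x \<noteq> r'"
      using x z[of a r] z[of a' r'] nz[of a r' r] nz[of a' r r'] 3 i j by metis+
    have "line_set q C (a, r) \<inter> line_set q C (a', r') = {Affine x (line_value q (a, r) x)}"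
    proof (intro equalityI subsetI)
      fix P assume "P \<in> line_set q C (a, r) \<inter> line_set q C (a', r')"
      then have "\<exists>y<q. P = Affine y (line_value q (a, r) y) \<and> line_value q (a, r) y = line_value q (a', r') y"
        using 3 by (auto simp: line_set_def)
      then show "P \<in> {Affine x (line_value q (a, r) x)}" using uniq by blast
    next
      fix P :: "'a point" assume "P \<in> {Affine x (line_value q (a, r) x)}"
      moreover have "x \<in> {..<q} - {r}" "x \<in> {..<q} - {r'}"
        using x \<open>x \<noteq> r\<close> \<open>x \<noteq> r'\<close> by auto
      ultimately show "P \<in> line_set q C (a, r) \<inter> line_set q C (a', r')"
        using x(2) by (simp add: line_set_def image_iff)
    qed
    then show ?thesis by simp
  qed
qed

text \<open>
  The size becomes quadratic in \<open>q\<close> while both bounds grow only by \<open>q\<close>: the quality of the new system is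
  governed by how small an inner system with \<open>q - 1\<close> members can be made.
\<close>

theorem cross_system_lines:
  assumes q: "prime q" and CD: "cross_system {1..<q} k l C D"
  shows "cross_system ({1..<q} \<times> {..<q}) (q + k) (q + l) (line_set q C) (column_set q D)"
proof -
  have CD1: "finite (C a)" "finite (D a)" "card (C a) \<le> k" "card (D a) \<le> l" "C a \<inter> D a = {}"
    if "a \<in> {1..<q}" for a
    using CD that by (auto simp: cross_system_def)
  have CD2: "card (C a \<inter> D a') = 1" "card (C a \<inter> C a') = 1"
    if "a \<in> {1..<q}" "a' \<in> {1..<q}" "a \<noteq> a'" for a a'
    using CD that by (auto simp: cross_system_def)
  have cl: "card (line_set q C (a, r)) \<le> q + k" if "a \<in> {1..<q}" "r < q" for a r
  proof -
    have "card (line_set q C (a, r)) \<le> card ((\<lambda>x. Affine x (line_value q (a, r) x) :: 'a point) ` ({..<q} - {r}))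
        + card {Slope a :: 'a point} + card (Aux r ` C a)"
      unfolding line_set_def prod.case
      by (rule order.trans[OF card_Un_le]) (intro add_mono card_Un_le order.refl)
    also have "\<dots> \<le> (q - 1) + 1 + k"
      using CD1[OF that(1)] that card_image_le[of "{..<q} - {r}"] by (intro add_mono) (auto simp: order.trans)
    finally show ?thesis using that by simp
  qed
  have cc: "card (column_set q D (a, r)) \<le> q + l" if "a \<in> {1..<q}" "r < q" for a r
  proof -
    have "card (column_set q D (a, r)) \<le> card (Affine r ` {1..<int q} :: 'a point set) + card (Aux r ` D a)"
      unfolding column_set_def prod.case by (rule card_Un_le)
    also have "\<dots> \<le> q + l"
      using CD1[OF that(1)] card_image_le[of "{1..<int q}" "Affine r :: _ \<Rightarrow> 'a point"]
      by (intro add_mono) auto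
    finally show ?thesis .
  qed
  have fin: "finite (line_set q C (a, r))" "finite (column_set q D (a, r))" if "a \<in> {1..<q}" for a r
    using CD1[OF that] by (auto simp: line_set_def column_set_def)
  show ?thesis
    unfolding cross_system_def
  proof (intro conjI ballI impI)
    fix i assume "i \<in> {1..<q} \<times> {..<q}"
    then obtain a r where i: "i = (a, r)" "a \<in> {1..<q}" "r < q" by auto
    show "finite (line_set q C i)" unfolding i(1) by (rule fin(1)[OF i(2)])
    show "finite (column_set q D i)" unfolding i(1) by (rule fin(2)[OF i(2)])
    show "card (line_set q C i) \<le> q + k" unfolding i(1) by (rule cl[OF i(2,3)])
    show "card (column_set q D i) \<le> q + l" unfolding i(1) by (rule cc[OF i(2,3)])
    show "line_set q C i \<inter> column_set q D i = {}"
      unfolding i(1) by (rule line_column_disjoint) (rule CD1(5)[OF i(2)])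
    fix j assume jI: "j \<in> {1..<q} \<times> {..<q}" and ne: "i \<noteq> j"
    obtain a' r' where j1: "j = (a', r')" by (cases j)
    have j: "j = (a', r')" "a' \<in> {1..<q}" "r' < q" "(a, r) \<noteq> (a', r')"
      using jI ne unfolding i(1) j1 by simp_all
    show "card (line_set q C i \<inter> column_set q D j) = 1"
      unfolding i(1) j(1) by (rule line_column_meet[OF q i(2,3) j(3,4)]) (rule CD2(1)[OF i(2) j(2)])
    show "card (line_set q C i \<inter> line_set q C j) = 1"
      unfolding i(1) j(1) by (rule line_line_meet[OF q i(2,3) j(2,3,4)]) (rule CD2(2)[OF i(2) j(2)])
  qed
qed

text \<open>
  The construction is applied twice: for \<open>p\<close> to the star, which gives an inner system with bounds linear
  in \<open>p\<close>, and then for \<open>q\<close>. With \<open>p\<close> of order \<open>sqrt q\<close> the overhead \<open>2 p + 2\<close> is negligible.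
\<close>

lemma prime_system_size:
  assumes q: "prime q" and p: "prime p" and pq: "q \<le> p * (p - 1)" and n: "q + 2 * p + 2 \<le> n"
  shows "q * (q - 1) \<le> g n"
proof -
  have p1: "p \<ge> 2" and q1: "q \<ge> 2" using p q prime_ge_2_nat by auto
  \<comment> \<open>The inner system for \<open>q\<close> is a part of the one for \<open>p\<close>, whose index set is enumerated row by row.\<close>
  define f where "f i = (Suc (i div p), i mod p)" for i
  have sys: "cross_system ({1..<p} \<times> {..<p}) (p + 2) (p + p)
      (line_set p (\<lambda>i. {0::nat, i})) (column_set p (\<lambda>i. {1..<p} - {i}))"
    by (rule cross_system_lines[OF p cross_system_star])
  have inj: "inj_on f {1..<q}"
  proof (rule inj_onI)
    fix i j assume "f i = f j"
    then show "i = j" by (metis Pair_inject Suc_inject div_mult_mod_eq f_def)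
  qed
  have img: "f ` {1..<q} \<subseteq> {1..<p} \<times> {..<p}"
  proof
    fix x assume "x \<in> f ` {1..<q}"
    then obtain i where i: "i < q" "x = f i" by auto
    have "i < (p - 1) * p" using i pq by (simp add: mult.commute)
    then have "i div p < p - 1" by (rule less_mult_imp_div_less)
    then show "x \<in> {1..<p} \<times> {..<p}" using i p1 by (auto simp: f_def)
  qed
  note cross_system_lines[OF q cross_system_reindex[OF sys inj img]]
  from cross_system_mono[OF this, of n n]
  have "cross_system ({1..<q} \<times> {..<q}) n n
      (line_set q (line_set p (\<lambda>i. {0::nat, i}) \<circ> f)) (column_set q (column_set p (\<lambda>i. {1..<p} - {i}) \<circ> f))"
    using n by simp
  then have "card ({1..<q} \<times> {..<q}) \<in> admissible_sizes n"
  proof (rule cross_system_imp_admissible_size)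
    have "1 * 2 \<le> (q - 1) * q" using q1 by (intro mult_mono) auto
    then show "2 \<le> card ({1..<q} \<times> {..<q})" by (simp add: card_cartesian_product)
  qed auto
  then have "(q - 1) * q \<in> admissible_sizes n" by (simp add: card_cartesian_product)
  then show ?thesis
    unfolding g_def using Max_ge[OF finite_admissible_sizes] by (simp add: mult.commute)
qed

section \<open>The zeta function and the von Mangoldt series\<close>

definition zeta :: "complex \<Rightarrow> complex" where
  "zeta s = (\<Sum>n. of_nat n powr (-s))"

definition mangoldt_series :: "complex \<Rightarrow> complex" where
  "mangoldt_series s = (\<Sum>n. mangoldt n * of_nat n powr (-s))"

lemma norm_nat_powr: "norm (of_nat n powr s :: complex) = real n powr Re s"
  using norm_powr_real_powr[of "of_nat n" s] by (cases "n = 0") auto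

lemma summable_nat_powr:
  assumes "Re s > 1"
  shows "summable (\<lambda>n. norm (of_nat n powr (-s) :: complex))"
  using assms by (simp add: norm_nat_powr summable_real_powr_iff)

lemma zeta_sums:
  assumes "Re s > 1"
  shows "(\<lambda>n. of_nat n powr (-s)) sums zeta s"
  using summable_nat_powr[OF assms] unfolding zeta_def
  by (rule summable_sums[OF summable_norm_cancel])

text \<open>
  Termwise differentiation of a locally uniformly convergent series of holomorphic functions; it also
  yields the convergence of the differentiated series for free.
\<close>

lemma zeta_deriv_sums:
  assumes "Re s > 1"
  shows "(zeta has_field_derivative deriv zeta s) (at s)"
    and "(\<lambda>n. - of_real (ln (real n)) * of_nat n powr (-s)) sums deriv zeta s"
proof -
  have "\<exists>g g'. \<forall>s\<in>{s. Re s > 1}. ((\<lambda>n. (of_nat n :: complex) powr (-s)) sums g s) \<and>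
      ((\<lambda>n. - of_real (ln (real n)) * of_nat n powr (-s)) sums g' s) \<and>
      (g has_field_derivative g' s) (at s)"
  proof (rule series_and_derivative_comparison_local)
    show "open {s. Re s > 1}" by (rule open_halfspace_Re_gt)
    show "((\<lambda>s. (of_nat n :: complex) powr (-s)) has_field_derivative
        - of_real (ln (real n)) * of_nat n powr (-s)) (at s)" if "s \<in> {s. Re s > 1}" for n s
    proof (cases "n = 0")
      case False
      then show ?thesis
        using DERIV_chain2[OF has_field_derivative_powr_right[of "of_nat n" "-s"]
            DERIV_minus[OF DERIV_ident[of "at s"]]] Ln_of_nat[of n]
        by (simp add: mult_ac)
    qed auto
    fix s assume s: "s \<in> {s::complex. Re s > 1}"
    define d where "d = (Re s - 1) / 2"
    have "summable (\<lambda>n. real n powr (-(1 + d)))"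
      using s by (subst summable_real_powr_iff) (auto simp: d_def)
    moreover have "norm ((of_nat n :: complex) powr (-y)) \<le> real n powr (-(1+d))"
      if "y \<in> ball s d" for n y
    proof (cases "n = 0")
      case False
      have "Re s - Re y \<le> d"
        using that abs_Re_le_cmod[of "s - y"] by (auto simp: dist_norm)
      then have "1 + d \<le> Re y" by (simp add: d_def field_simps)
      then show ?thesis using False by (auto simp: norm_nat_powr intro!: powr_mono)
    qed auto
    ultimately show "\<exists>d h. 0 < d \<and> summable h \<and> (\<forall>\<^sub>F n in sequentially.
        \<forall>y\<in>ball s d \<inter> {s. Re s > 1}. norm ((of_nat n :: complex) powr (-y)) \<le> h n)"
      using s by (intro exI[of _ d] exI[of _ "\<lambda>n. real n powr (-(1 + d))"]) (auto simp: d_def)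
  qed
  then obtain g g' where g: "\<And>s. Re s > 1 \<Longrightarrow> (\<lambda>n. (of_nat n :: complex) powr (-s)) sums g s"
      "\<And>s. Re s > 1 \<Longrightarrow> (\<lambda>n. - of_real (ln (real n)) * of_nat n powr (-s)) sums g' s"
      "\<And>s. Re s > 1 \<Longrightarrow> (g has_field_derivative g' s) (at s)"
    by auto
  have eq: "g s = zeta s" if "Re s > 1" for s
    using g(1)[OF that] zeta_sums[OF that] by (rule sums_unique2)
  have "(zeta has_field_derivative g' s) (at s)"
    using g(3)[OF assms] open_halfspace_Re_gt[of 1]
    by (rule has_field_derivative_transform_within_open) (use assms eq in auto)
  then have "deriv zeta s = g' s" by (rule DERIV_imp_deriv)
  with g(2)[OF assms] \<open>(zeta has_field_derivative g' s) (at s)\<close>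
  show "(zeta has_field_derivative deriv zeta s) (at s)"
    and "(\<lambda>n. - of_real (ln (real n)) * of_nat n powr (-s)) sums deriv zeta s"
    by auto
qed

lemma summable_ln_powr:
  assumes "\<sigma> > 1"
  shows "summable (\<lambda>n. ln (real n) * real n powr (-\<sigma>))"
proof -
  have "summable (\<lambda>n. - of_real (ln (real n)) * of_nat n powr (-(of_real \<sigma>)) :: complex)"
    using zeta_deriv_sums(2)[of "of_real \<sigma>"] assms by (auto simp: sums_iff)
  moreover have "(of_nat n :: complex) powr (-(of_real \<sigma>)) = of_real (real n powr (-\<sigma>))" for n
    using powr_of_real[of "real n" "-\<sigma>"] by simp
  ultimately have "summable (\<lambda>n. - complex_of_real (ln (real n) * real n powr (-\<sigma>)))"
    by simp
  from summable_Re[OF summable_minus[OF this]] show ?thesis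
    by simp
qed

lemma summable_mangoldt_powr:
  assumes "\<sigma> > 1"
  shows "summable (\<lambda>n. mangoldt n * real n powr (-\<sigma>))"
proof (rule summable_comparison_test'[OF summable_ln_powr[OF assms], of 1])
  show "norm (mangoldt n * real n powr (-\<sigma>)) \<le> ln (real n) * real n powr (-\<sigma>)" if "n \<ge> 1" for n
    using that mangoldt_le[of n] by (auto simp: abs_mult intro!: mult_right_mono)
qed

lemma mangoldt_series_sums:
  assumes "Re s > 1"
  shows "(\<lambda>n. mangoldt n * of_nat n powr (-s)) sums mangoldt_series s"
    and "summable (\<lambda>n. norm (mangoldt n * of_nat n powr (-s) :: complex))"
proof -
  show *: "summable (\<lambda>n. norm (mangoldt n * of_nat n powr (-s) :: complex))"
    using summable_mangoldt_powr[of "Re s"] assms by (simp add: norm_mult norm_nat_powr)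
  show "(\<lambda>n. mangoldt n * of_nat n powr (-s)) sums mangoldt_series s"
    unfolding mangoldt_series_def using * by (rule summable_sums[OF summable_norm_cancel])
qed

text \<open>
  The Dirichlet convolution of the von Mangoldt function with the constant 1 is the logarithm.
  Absolute convergence permits regrouping the double series by the product of the two indices.
\<close>

lemma mangoldt_series_times_zeta:
  assumes s: "Re s > 1"
  shows "mangoldt_series s * zeta s = - deriv zeta s"
proof -
  let ?f = "\<lambda>n. mangoldt n * of_nat n powr (-s) :: complex"
  let ?g = "\<lambda>n. of_nat n powr (-s) :: complex"
  have f: "(?f has_sum mangoldt_series s) UNIV"
    by (rule norm_summable_imp_has_sum[OF mangoldt_series_sums(2,1)[OF s]])
  have g: "(?g has_sum zeta s) UNIV"
    by (rule norm_summable_imp_has_sum[OF summable_nat_powr[OF s] zeta_sums[OF s]])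
  have nf: "(\<lambda>n. norm (?f n)) summable_on UNIV"
    using summable_on_iff_abs_summable_on_complex[THEN iffD1, OF has_sum_imp_summable[OF f]] .
  have ng: "(\<lambda>n. norm (?g n)) summable_on UNIV"
    using summable_on_iff_abs_summable_on_complex[THEN iffD1, OF has_sum_imp_summable[OF g]] .
  have abs: "(\<lambda>x. norm (case x of (d, k) \<Rightarrow> ?f d * ?g k)) summable_on UNIV \<times> UNIV"
  proof (rule summable_on_SigmaI)
    show "((\<lambda>k. norm (case (d, k) of (d, k) \<Rightarrow> ?f d * ?g k)) has_sum
        (norm (?f d) * (\<Sum>\<^sub>\<infinity>k. norm (?g k)))) UNIV" for d
      using has_sum_cmult_right[OF has_sum_infsum[OF ng], of "norm (?f d)"]
      by (simp only: prod.case norm_mult)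
    show "(\<lambda>d. norm (?f d) * (\<Sum>\<^sub>\<infinity>k. norm (?g k))) summable_on UNIV"
      using nf by (rule summable_on_cmult_left)
  qed auto
  have fg: "((\<lambda>(d, k). ?f d * ?g k) has_sum (mangoldt_series s * zeta s)) (UNIV \<times> UNIV)"
  proof (rule has_sum_SigmaI)
    show "((\<lambda>k. case (d, k) of (d, k) \<Rightarrow> ?f d * ?g k) has_sum (?f d * zeta s)) UNIV" for d
      using has_sum_cmult_right[OF g, of "?f d"] by (simp only: prod.case)
    show "((\<lambda>d. ?f d * zeta s) has_sum mangoldt_series s * zeta s) UNIV"
      by (rule has_sum_cmult_left[OF f])
    show "(\<lambda>(d, k). ?f d * ?g k) summable_on UNIV \<times> UNIV"
      by (rule abs_summable_summable[OF abs])
  qed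
  have "((\<lambda>(d, k). ?f d * ?g k) has_sum (mangoldt_series s * zeta s)) ({1..} \<times> {1..})"
    (is ?A)
  proof -
    have "((\<lambda>(d, k). ?f d * ?g k) has_sum (mangoldt_series s * zeta s)) (UNIV \<times> UNIV) \<longleftrightarrow> ?A"
      by (rule has_sum_cong_neutral) (auto simp: not_le)
    with fg show ?A by blast
  qed
  also have "?this \<longleftrightarrow> ((\<lambda>(n, d). mangoldt d * of_nat n powr (-s)) has_sum (mangoldt_series s * zeta s))
      (Sigma {1..} (\<lambda>n. {d. d dvd n}))"
  proof (rule has_sum_reindex_bij_witness[of _ "\<lambda>(n, d). (d, n div d)" "\<lambda>(d, k). (d * k, d)"])
    fix x :: "nat \<times> nat" assume "x \<in> {1..} \<times> {1..}"
    then obtain d k where x: "x = (d, k)" "d \<ge> 1" "k \<ge> 1" by auto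
    then show "(case (case x of (d, k) \<Rightarrow> (d * k, d)) of (n, d) \<Rightarrow> (d, n div d)) = x"
      and "(case x of (d, k) \<Rightarrow> (d * k, d)) \<in> Sigma {1..} (\<lambda>n. {d. d dvd n})"
      by auto
    have "(complex_of_real (real d) * complex_of_real (real k)) powr (-s)
        = complex_of_real (real d) powr (-s) * complex_of_real (real k) powr (-s)"
      by (rule powr_times_real) auto
    then show "(case (case x of (d, k) \<Rightarrow> (d * k, d)) of (n, d) \<Rightarrow> mangoldt d * of_nat n powr (-s))
        = (case x of (d, k) \<Rightarrow> ?f d * ?g k)"
      using x by (simp add: mult.assoc)
  next
    fix y :: "nat \<times> nat" assume "y \<in> Sigma {1..} (\<lambda>n. {d. d dvd n})"
    then obtain n d where y: "y = (n, d)" "n \<ge> 1" "d dvd n" by auto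
    then have "d \<ge> 1" "n div d \<ge> 1" "d * (n div d) = n" by (auto simp: Suc_le_eq intro!: Nat.gr0I)
    with y show "(case (case y of (n, d) \<Rightarrow> (d, n div d)) of (d, k) \<Rightarrow> (d * k, d)) = y"
      and "(case y of (n, d) \<Rightarrow> (d, n div d)) \<in> {1..} \<times> {1..}"
      by auto
  qed simp
  finally have S: "((\<lambda>(n, d). mangoldt d * of_nat n powr (-s)) has_sum (mangoldt_series s * zeta s))
      (Sigma {1..} (\<lambda>n. {d. d dvd n}))" .
  have "((\<lambda>n. of_real (ln (real n)) * ?g n) has_sum (mangoldt_series s * zeta s)) {1..}"
  proof (rule has_sum_SigmaD[OF S])
    fix n :: nat assume n: "n \<in> {1..}"
    have "((\<lambda>d. mangoldt d * ?g n) has_sum (\<Sum>d | d dvd n. mangoldt d * ?g n)) {d. d dvd n}"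
      using n by (intro has_sum_finite) auto
    also have "(\<Sum>d | d dvd n. mangoldt d * ?g n) = of_real (ln (real n)) * ?g n"
      using n by (subst mangoldt_sum[symmetric]) (auto simp: sum_distrib_right)
    finally show "((\<lambda>d. case (n, d) of (n, d) \<Rightarrow> mangoldt d * of_nat n powr (-s))
        has_sum of_real (ln (real n)) * ?g n) {d. d dvd n}" by simp
  qed
  also have "?this \<longleftrightarrow> ((\<lambda>n. of_real (ln (real n)) * ?g n) has_sum (mangoldt_series s * zeta s)) UNIV"
    by (rule has_sum_cong_neutral) (auto simp: not_le)
  finally have "(\<lambda>n. of_real (ln (real n)) * ?g n) sums (mangoldt_series s * zeta s)"
    by (rule has_sum_imp_sums)
  moreover have "(\<lambda>n. of_real (ln (real n)) * ?g n) sums (- deriv zeta s)"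
    using sums_minus[OF zeta_deriv_sums(2)[OF s]] by simp
  ultimately show ?thesis by (rule sums_unique2)
qed

section \<open>Continuation to the right half-plane\<close>

text \<open>
  The identity \<open>(s - 1) zeta s = 1 + (\<Sum>n. (s - 1) n powr (-s) - (n powr (1 - s) - (n + 1) powr (1 - s)))\<close>
  compares the series with its telescoping integral. The terms are entire and of size
  \<open>n powr (- Re s - 1)\<close>, so the right-hand side continues \<open>(s - 1) zeta s\<close> to \<open>Re s > 0\<close> and
  the pole at 1 needs no separate treatment.
\<close>

definition entire_term :: "nat \<Rightarrow> complex \<Rightarrow> complex" where
  "entire_term n s = (s - 1) * of_nat (Suc n) powr (-s)
     - of_nat (Suc n) powr (1 - s) + of_nat (Suc (Suc n)) powr (1 - s)"

definition zeta_reg :: "complex \<Rightarrow> complex" where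
  "zeta_reg s = 1 + (\<Sum>n. entire_term n s)"

lemma closed_segment_succE:
  assumes "z \<in> closed_segment (complex_of_real a) (of_real (a + 1))"
  obtains x where "z = of_real x" "a \<le> x" "x \<le> a + 1"
  using assms unfolding closed_segment_of_real by (auto simp: closed_segment_eq_real_ivl simp del: of_real_add)

lemma norm_powr_diff_le:
  assumes a: "a \<ge> 1" and x: "a \<le> x" "x \<le> a + 1" and s: "Re s > 0"
  shows "norm (of_real x powr (-s) - of_real a powr (-s) :: complex) \<le> norm s * a powr (- Re s - 1)"
proof -
  let ?S = "closed_segment (complex_of_real a) (of_real (a + 1))"
  have "norm (of_real x powr (-s) - of_real a powr (-s) :: complex)
      \<le> (norm s * a powr (- Re s - 1)) * norm (complex_of_real x - of_real a)"
  proof (rule field_differentiable_bound[of ?S])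
    fix z assume "z \<in> ?S"
    then obtain y where y: "z = of_real y" "a \<le> y" "y \<le> a + 1" by (rule closed_segment_succE)
    have "z \<notin> \<real>\<^sub>\<le>\<^sub>0" using y a by auto
    then show "((\<lambda>z. z powr (-s)) has_field_derivative (- s * z powr (- s - 1))) (at z within ?S)"
      using has_field_derivative_powr[of z "-s"] by (metis has_field_derivative_at_within)
    have "norm (z powr (- s - 1)) = y powr (- Re s - 1)"
      using y a by (simp add: norm_powr_real_powr)
    also have "\<dots> \<le> a powr (- Re s - 1)"
      using y a s by (intro powr_mono2') auto
    finally show "norm (- s * z powr (- s - 1)) \<le> norm s * a powr (- Re s - 1)"
      by (simp add: norm_mult mult_left_mono)
  next
    show "complex_of_real x \<in> ?S"
      unfolding closed_segment_of_real using x by (auto simp: closed_segment_eq_real_ivl)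
  qed auto
  also have "\<dots> \<le> norm s * a powr (- Re s - 1) * 1"
    using x by (intro mult_left_mono) (auto simp flip: of_real_diff)
  finally show ?thesis by simp
qed

text \<open>
  The term is the increment over \<open>[n, n + 1]\<close> of a function whose derivative
  \<open>(s - 1) (n powr (-s) - x powr (-s))\<close> is again a small increment.
\<close>

lemma norm_entire_term_le:
  assumes s: "Re s > 0"
  shows "norm (entire_term n s) \<le> norm (s - 1) * norm s * real (Suc n) powr (- Re s - 1)"
proof -
  define a where "a = real (Suc n)"
  have a: "a \<ge> 1" by (simp add: a_def)
  let ?S = "closed_segment (complex_of_real a) (of_real (a + 1))"
  let ?B = "norm (s - 1) * (norm s * a powr (- Re s - 1))"
  define h where "h z = (s - 1) * of_real a powr (-s) * (z - of_real a) + z powr (1 - s)" for z :: complex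
  have "norm (h (of_real (a + 1)) - h (of_real a)) \<le> ?B * norm (of_real (a + 1) - complex_of_real a)"
  proof (rule field_differentiable_bound[of ?S])
    fix z assume "z \<in> ?S"
    then obtain y where y: "z = of_real y" "a \<le> y" "y \<le> a + 1" by (rule closed_segment_succE)
    have "z \<notin> \<real>\<^sub>\<le>\<^sub>0" using y a by auto
    then show "(h has_field_derivative (s - 1) * (of_real a powr (-s) - z powr (-s))) (at z within ?S)"
      unfolding h_def
      by - (rule has_field_derivative_at_within,
          auto intro!: derivative_eq_intros simp: algebra_simps simp del: of_real_add)
    show "norm ((s - 1) * (of_real a powr (-s) - z powr (-s))) \<le> ?B"
      unfolding norm_mult using norm_powr_diff_le[OF a y(2,3) s] y
      by (intro mult_left_mono) (auto simp: norm_minus_commute)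
  qed auto
  also have "h (of_real (a + 1)) - h (of_real a) = entire_term n s"
    by (simp add: h_def entire_term_def a_def)
  finally show ?thesis by (simp add: a_def)
qed

lemma summable_entire_bound: "\<sigma> > 0 \<Longrightarrow> summable (\<lambda>n. real (Suc n) powr (-\<sigma> - 1))"
  by (subst summable_Suc_iff[of "\<lambda>n. real n powr (-\<sigma> - 1)"]) (simp add: summable_real_powr_iff)

lemma entire_term_sums:
  assumes "Re s > 0"
  shows "(\<lambda>n. entire_term n s) sums (zeta_reg s - 1)"
proof -
  have "summable (\<lambda>n. entire_term n s)"
    by (rule summable_comparison_test'[OF summable_mult[OF summable_entire_bound[OF assms],
          of "norm (s - 1) * norm s"]]) (rule norm_entire_term_le[OF assms])
  then show ?thesis by (simp add: zeta_reg_def summable_sums)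
qed

lemma zeta_reg_holomorphic: "zeta_reg holomorphic_on {s. Re s > 0}"
proof -
  have "\<exists>g g'. \<forall>s\<in>{s. Re s > 0}. ((\<lambda>n. entire_term n s) sums g s) \<and>
      ((\<lambda>n. deriv (entire_term n) s) sums g' s) \<and> (g has_field_derivative g' s) (at s)"
  proof (rule series_and_derivative_comparison_local)
    show "open {s. Re s > 0}" by (rule open_halfspace_Re_gt)
    show "(entire_term n has_field_derivative deriv (entire_term n) s) (at s)" for n s
    proof -
      have "entire_term n holomorphic_on UNIV"
        unfolding entire_term_def by (auto intro!: holomorphic_intros)
      then show ?thesis by (simp add: holomorphic_derivI)
    qed
    fix s assume s: "s \<in> {s::complex. Re s > 0}"
    define d where "d = Re s / 2"
    define C where "C = (norm s + d + 1) * (norm s + d)"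
    have "summable (\<lambda>n. C * real (Suc n) powr (-d - 1))"
      using s by (intro summable_mult summable_entire_bound) (simp add: d_def)
    moreover have "norm (entire_term n y) \<le> C * real (Suc n) powr (-d - 1)"
      if y: "y \<in> ball s d" for n y
    proof -
      have "Re s - Re y \<le> d"
        using y abs_Re_le_cmod[of "s - y"] by (auto simp: dist_norm)
      then have dy: "d \<le> Re y" by (simp add: d_def)
      have ny: "norm y \<le> norm s + d"
        using y norm_triangle_sub[of y s] by (auto simp: dist_norm norm_minus_commute)
      have "norm (y - 1) \<le> norm s + d + 1"
        using ny norm_triangle_ineq4[of y 1] by simp
      then have "norm (y - 1) * norm y \<le> C"
        unfolding C_def using ny s by (intro mult_mono) (auto simp: d_def)
      moreover have "real (Suc n) powr (-Re y - 1) \<le> real (Suc n) powr (-d - 1)"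
        using dy by (intro powr_mono) auto
      ultimately have "norm (y - 1) * norm y * real (Suc n) powr (-Re y - 1) \<le> C * real (Suc n) powr (-d - 1)"
        using s by (intro mult_mono) (auto simp: C_def d_def)
      with norm_entire_term_le[of y n] dy s show ?thesis by (auto simp: d_def)
    qed
    ultimately show "\<exists>d h. 0 < d \<and> summable h \<and> (\<forall>\<^sub>F n in sequentially.
        \<forall>y\<in>ball s d \<inter> {s. Re s > 0}. norm (entire_term n y) \<le> h n)"
      using s by (intro exI[of _ d] exI[of _ "\<lambda>n. C * real (Suc n) powr (-d - 1)"]) (auto simp: d_def)
  qed
  then obtain g g' where g: "\<And>s. Re s > 0 \<Longrightarrow> (\<lambda>n. entire_term n s) sums g s"
      "\<And>s. Re s > 0 \<Longrightarrow> (g has_field_derivative g' s) (at s)" by auto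
  have "g holomorphic_on {s. Re s > 0}"
    using g(2) open_halfspace_Re_gt[of 0] by (auto simp: holomorphic_on_open)
  then have "(\<lambda>s. 1 + g s) holomorphic_on {s. Re s > 0}" by (intro holomorphic_intros)
  moreover have "1 + g s = zeta_reg s" if "Re s > 0" for s
    using g(1)[OF that] by (simp add: zeta_reg_def sums_iff)
  ultimately show ?thesis
    by (subst holomorphic_cong[OF refl, of _ _ "\<lambda>s. 1 + g s"]) auto
qed

lemma zeta_reg_1 [simp]: "zeta_reg 1 = 1"
proof -
  have "entire_term n 1 = 0" for n unfolding entire_term_def by (simp del: of_nat_Suc)
  then show ?thesis by (simp add: zeta_reg_def)
qed

lemma zeta_reg_eq:
  assumes "Re s > 1"
  shows "zeta_reg s = (s - 1) * zeta s"
proof -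
  have "(\<lambda>n. of_nat (Suc n) powr (-s) :: complex) sums zeta s"
    using zeta_sums[OF assms] by (subst sums_Suc_iff) auto
  then have "(\<lambda>n. (s - 1) * of_nat (Suc n) powr (-s)) sums ((s - 1) * zeta s)"
    by (rule sums_mult)
  moreover have "(\<lambda>n. (of_nat (Suc n) :: complex) powr (1 - s)) \<longlonglongrightarrow> 0"
  proof (rule tendsto_norm_zero_cancel)
    have "((\<lambda>x. x powr (1 - Re s)) \<longlongrightarrow> 0) at_top"
      using assms by (intro tendsto_neg_powr filterlim_ident) auto
    from filterlim_compose[OF this filterlim_compose[OF filterlim_real_sequentially filterlim_Suc]]
    show "(\<lambda>n. norm ((of_nat (Suc n) :: complex) powr (1 - s))) \<longlonglongrightarrow> 0"
      by (simp add: norm_nat_powr del: of_nat_Suc)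
  qed
  from telescope_sums'[OF this]
  have "(\<lambda>n. of_nat (Suc n) powr (1 - s) - of_nat (Suc (Suc n)) powr (1 - s) :: complex) sums 1"
    by simp
  ultimately have "(\<lambda>n. (s - 1) * of_nat (Suc n) powr (-s)
      - (of_nat (Suc n) powr (1 - s) - of_nat (Suc (Suc n)) powr (1 - s))) sums ((s - 1) * zeta s - 1)"
    by (rule sums_diff)
  then have "(\<lambda>n. entire_term n s) sums ((s - 1) * zeta s - 1)"
    by (simp add: entire_term_def algebra_simps)
  from sums_unique2[OF this entire_term_sums[of s]] assms show ?thesis by simp
qed

text \<open>
  The logarithmic derivative in a form free of division by \<open>zeta_reg s\<close>, so that it can serve to
  prove that there are no zeros.
\<close>

lemma deriv_zeta_reg:
  assumes s: "Re s > 1"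
  shows "deriv zeta_reg s = zeta_reg s * (1 / (s - 1) - mangoldt_series s)"
proof -
  have "((\<lambda>s. (s - 1) * zeta s) has_field_derivative (zeta s + (s - 1) * deriv zeta s)) (at s)"
    by (auto intro!: derivative_eq_intros zeta_deriv_sums(1)[OF s])
  then have "(zeta_reg has_field_derivative (zeta s + (s - 1) * deriv zeta s)) (at s)"
    by (rule has_field_derivative_transform_within_open[OF _ open_halfspace_Re_gt[of 1]])
       (use s zeta_reg_eq in auto)
  then have "deriv zeta_reg s = zeta s + (s - 1) * deriv zeta s" by (rule DERIV_imp_deriv)
  also have "deriv zeta s = - (mangoldt_series s * zeta s)"
    using mangoldt_series_times_zeta[OF s] by simp
  also have "zeta s + (s - 1) * - (mangoldt_series s * zeta s)
      = zeta_reg s * (1 / (s - 1) - mangoldt_series s)"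
  proof -
    have "s - 1 \<noteq> 0" using s by auto
    then show ?thesis unfolding zeta_reg_eq[OF s] right_diff_distrib by simp
  qed
  finally show ?thesis .
qed

text \<open>
  The residue of a logarithmic derivative is the order of the zero; only the radial limit is needed
  below.
\<close>

lemma logderiv_tendsto_order:
  assumes f: "f holomorphic_on S" and S: "open S" "connected S" and z: "z \<in> S"
    and nz: "\<exists>w\<in>S. f w \<noteq> 0"
  obtains k :: nat where "f z = 0 \<longleftrightarrow> k > 0" "eventually (\<lambda>w. f w \<noteq> 0) (at z)"
    "((\<lambda>w. (w - z) * (deriv f w / f w)) \<longlongrightarrow> of_nat k) (at z)"
proof -
  obtain g r k where r: "r > 0" "ball z r \<subseteq> S" and g: "g holomorphic_on ball z r"
    and fg: "\<And>w. w \<in> ball z r \<Longrightarrow> f w = (w - z) ^ k * g w"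
    and g0: "\<And>w. w \<in> ball z r \<Longrightarrow> g w \<noteq> 0" and k: "f z = 0 \<longleftrightarrow> k > 0"
  proof -
    from zorder_exist_zero[OF f S z nz] obtain r where
      r: "r > 0" "cball z r \<subseteq> S" "zor_poly f z holomorphic_on cball z r"
      "\<And>w. w \<in> cball z r \<Longrightarrow> f w = zor_poly f z w * (w - z) ^ nat (zorder f z) \<and> zor_poly f z w \<noteq> 0"
      and zo: "if f z = 0 then zorder f z > 0 else zorder f z = 0" by blast
    have b: "w \<in> ball z r \<Longrightarrow> w \<in> cball z r" for w by auto
    show ?thesis
      by (rule that[of r "zor_poly f z" "nat (zorder f z)"])
        (use r b zo in \<open>auto simp: mult.commute intro: holomorphic_on_subset split: if_splits\<close>)
  qed
  have ev: "eventually (\<lambda>w. w \<in> ball z r - {z}) (at z)"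
    using r eventually_at_ball'[of r z UNIV] by (auto elim: eventually_mono)
  have eq: "(w - z) * (deriv f w / f w) = of_nat k + (w - z) * (deriv g w / g w)"
    if w: "w \<in> ball z r - {z}" for w
  proof -
    have "(g has_field_derivative deriv g w) (at w)"
      using g w by (intro holomorphic_derivI) auto
    then have "((\<lambda>w. (w - z) ^ k * g w) has_field_derivative
        (of_nat k * (w - z) ^ (k - 1) * g w + (w - z) ^ k * deriv g w)) (at w)"
      by (auto intro!: derivative_eq_intros)
    then have "(f has_field_derivative
        (of_nat k * (w - z) ^ (k - 1) * g w + (w - z) ^ k * deriv g w)) (at w)"
      by (rule has_field_derivative_transform_within_open[of _ _ _ "ball z r"]) (use w fg in auto)
    then have d: "deriv f w = of_nat k * (w - z) ^ (k - 1) * g w + (w - z) ^ k * deriv g w"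
      by (rule DERIV_imp_deriv)
    define u where "u = w - z"
    have "g w \<noteq> 0" "u \<noteq> 0" using g0 w by (auto simp: u_def)
    moreover have "f w = u ^ k * g w" using fg[of w] w by (simp add: u_def)
    ultimately show ?thesis
      unfolding d u_def[symmetric] by (cases k) (simp_all add: divide_simps, simp_all add: algebra_simps)
  qed
  have "isCont (deriv g) z" "isCont g z"
    using g r holomorphic_deriv[OF g]
    by (auto intro!: holomorphic_on_imp_continuous_on continuous_on_interior[of "ball z r"])
  then have "((\<lambda>w. of_nat k + (w - z) * (deriv g w / g w)) \<longlongrightarrow> of_nat k + (z - z) * (deriv g z / g z)) (at z)"
    using g0[of z] r by (intro tendsto_intros) (auto simp: isCont_def)
  then have lim: "((\<lambda>w. (w - z) * (deriv f w / f w)) \<longlongrightarrow> of_nat k) (at z)"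
    by (subst tendsto_cong[OF eventually_mono[OF ev eq]]) (simp_all only: diff_self mult_zero_left add_0_right)
  have "eventually (\<lambda>w. f w \<noteq> 0) (at z)"
    using ev by eventually_elim (use fg g0 in auto)
  with lim k that show ?thesis by blast
qed

lemma zeta_reg_order:
  assumes "Re s > 0"
  obtains k :: nat where "zeta_reg s = 0 \<longleftrightarrow> k > 0"
    "((\<lambda>\<delta>. of_real \<delta> * (deriv zeta_reg (s + of_real \<delta>) / zeta_reg (s + of_real \<delta>)))
        \<longlongrightarrow> of_nat k) (at_right 0)"
    "eventually (\<lambda>\<delta>. zeta_reg (s + of_real \<delta>) \<noteq> 0) (at_right 0)"
proof -
  obtain k :: nat where k: "zeta_reg s = 0 \<longleftrightarrow> k > 0" "eventually (\<lambda>w. zeta_reg w \<noteq> 0) (at s)"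
    "((\<lambda>w. (w - s) * (deriv zeta_reg w / zeta_reg w)) \<longlongrightarrow> of_nat k) (at s)"
  proof (rule logderiv_tendsto_order[OF zeta_reg_holomorphic])
    show "\<exists>w\<in>{s. Re s > 0}. zeta_reg w \<noteq> 0" by (rule bexI[of _ 1]) auto
    show "connected {s. Re s > 0}"
      by (intro convex_connected convex_halfspace_Re_gt)
  qed (use assms open_halfspace_Re_gt in auto)
  have "((\<lambda>\<delta>::real. s + of_real \<delta>) \<longlongrightarrow> s + of_real 0) (at_right 0)"
    by (intro tendsto_intros)
  then have fl: "filterlim (\<lambda>\<delta>::real. s + of_real \<delta>) (at s) (at_right 0)"
    by (auto simp: filterlim_at eventually_at_filter)
  show ?thesis
  proof (rule that[OF k(1)])
    show "((\<lambda>\<delta>. of_real \<delta> * (deriv zeta_reg (s + of_real \<delta>) / zeta_reg (s + of_real \<delta>)))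
        \<longlongrightarrow> of_nat k) (at_right 0)"
      using filterlim_compose[OF k(3) fl] by simp
    show "eventually (\<lambda>\<delta>. zeta_reg (s + of_real \<delta>) \<noteq> 0) (at_right 0)"
      using eventually_compose_filterlim[OF k(2) fl] .
  qed
qed

section \<open>Absence of zeros on the line of real part one\<close>

lemma logderiv_zeta_reg:
  assumes "Re s > 1" "zeta_reg s \<noteq> 0"
  shows "deriv zeta_reg s / zeta_reg s = 1 / (s - 1) - mangoldt_series s"
  using deriv_zeta_reg[OF assms(1)] assms(2) by simp

lemma mangoldt_series_bound:
  assumes "\<sigma> > 1" "Re s \<ge> \<sigma>"
  shows "norm (mangoldt_series s) \<le> (\<Sum>n. mangoldt n * real n powr (-\<sigma>))"
  unfolding mangoldt_series_def
proof (rule norm_suminf_le[OF _ summable_mangoldt_powr[OF assms(1)]])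
  fix n
  show "norm (mangoldt n * of_nat n powr (-s) :: complex) \<le> mangoldt n * real n powr (-\<sigma>)"
    using assms mangoldt_nonneg[of n]
    by (cases "n = 0") (auto simp: norm_mult norm_nat_powr intro!: mult_left_mono powr_mono)
qed

text \<open>
  At a zero the logarithmic derivative would have a pole, but for \<open>Re s > 1\<close> it is
  \<open>1 / (s - 1) - mangoldt_series s\<close>, which is bounded near \<open>s\<close>.
\<close>

lemma zeta_reg_nonzero_gt_1:
  assumes s: "Re s > 1"
  shows "zeta_reg s \<noteq> 0"
proof -
  obtain k :: nat where k: "zeta_reg s = 0 \<longleftrightarrow> k > 0"
    "((\<lambda>\<delta>. of_real \<delta> * (deriv zeta_reg (s + of_real \<delta>) / zeta_reg (s + of_real \<delta>)))
        \<longlongrightarrow> of_nat k) (at_right 0)"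
    "eventually (\<lambda>\<delta>. zeta_reg (s + of_real \<delta>) \<noteq> 0) (at_right 0)"
    using zeta_reg_order[of s] s by auto
  define C where "C = (\<Sum>n. mangoldt n * real n powr (-Re s))"
  have ev: "eventually (\<lambda>\<delta>. norm (of_real \<delta> * (deriv zeta_reg (s + of_real \<delta>) / zeta_reg (s + of_real \<delta>)))
      \<le> \<delta> * (1 / (Re s - 1) + C)) (at_right 0)"
    using k(3) eventually_at_right_less[of "0::real"]
  proof eventually_elim
    case (elim \<delta>)
    let ?w = "s + of_real \<delta>"
    have w: "Re ?w \<ge> Re s" using elim by simp
    have "norm (?w - 1) \<ge> Re s - 1"
      using elim s complex_Re_le_cmod[of "?w - 1"] by simp
    then have "norm (1 / (?w - 1)) \<le> 1 / (Re s - 1)"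
      using s by (simp add: norm_divide frac_le)
    moreover have "norm (mangoldt_series ?w) \<le> C"
      unfolding C_def by (rule mangoldt_series_bound[OF s w])
    ultimately have "norm (1 / (?w - 1) - mangoldt_series ?w) \<le> 1 / (Re s - 1) + C"
      using norm_triangle_ineq4[of "1 / (?w - 1)" "mangoldt_series ?w"] by linarith
    then show ?case
      using elim w s by (subst logderiv_zeta_reg) (auto simp: norm_mult intro!: mult_left_mono)
  qed
  have "((\<lambda>\<delta>::real. \<delta> * (1 / (Re s - 1) + C)) \<longlongrightarrow> 0 * (1 / (Re s - 1) + C)) (at_right 0)"
    by (intro tendsto_intros)
  then have "((\<lambda>\<delta>::real. \<delta> * (1 / (Re s - 1) + C)) \<longlongrightarrow> 0) (at_right 0)" by simp
  from Lim_null_comparison[OF ev this]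
  have "of_nat k = (0::complex)" using k(2) by (intro tendsto_unique[OF _ k(2)]) auto
  with k(1) show ?thesis by simp
qed

lemma three_four_one: "3 + 4 * cos x + cos (2 * x) \<ge> (0::real)"
proof -
  have "3 + 4 * cos x + cos (2 * x) = 2 * (1 + cos x)\<^sup>2"
    unfolding cos_double_cos power2_eq_square by (simp add: algebra_simps)
  then show ?thesis by simp
qed

lemma Re_mangoldt_series_sums:
  assumes "\<sigma> > 1"
  shows "(\<lambda>n. mangoldt n * real n powr (-\<sigma>) * cos (t * ln (real n))) sums Re (mangoldt_series (Complex \<sigma> t))"
proof -
  have "Re (mangoldt n * of_nat n powr (- Complex \<sigma> t)) = mangoldt n * real n powr (-\<sigma>) * cos (t * ln (real n))" for n
  proof (cases "n = 0")
    case False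
    then have "of_nat n powr (- Complex \<sigma> t) = exp (- Complex \<sigma> t * of_real (ln (real n)))"
      by (simp add: powr_def Ln_of_nat)
    also have "Re \<dots> = real n powr (-\<sigma>) * cos (t * ln (real n))"
      using False by (simp add: Re_exp powr_def)
    finally have "Re (of_nat n powr (- Complex \<sigma> t)) = real n powr (-\<sigma>) * cos (t * ln (real n))" .
    moreover have "Re (mangoldt n * z) = mangoldt n * Re z" for z by simp
    ultimately show ?thesis by simp
  qed auto
  then show ?thesis
    using sums_Re[OF mangoldt_series_sums(1)[of "Complex \<sigma> t"]] assms by (simp only: complex.sel)
qed

lemma Re_mangoldt_series_341:
  assumes "\<sigma> > 1"
  shows "3 * Re (mangoldt_series (Complex \<sigma> 0)) + 4 * Re (mangoldt_series (Complex \<sigma> t))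
      + Re (mangoldt_series (Complex \<sigma> (2 * t))) \<ge> 0"
proof -
  note S = Re_mangoldt_series_sums[OF assms]
  have S': "(\<lambda>n. 3 * (mangoldt n * real n powr (-\<sigma>) * cos (0 * ln (real n)))
      + 4 * (mangoldt n * real n powr (-\<sigma>) * cos (t * ln (real n)))
      + mangoldt n * real n powr (-\<sigma>) * cos (2 * t * ln (real n)))
     sums (3 * Re (mangoldt_series (Complex \<sigma> 0)) + 4 * Re (mangoldt_series (Complex \<sigma> t))
      + Re (mangoldt_series (Complex \<sigma> (2 * t))))" (is "?f sums _")
    by (intro sums_add sums_mult S)
  have nn: "0 \<le> ?f n" for n
  proof -
    have "?f n = mangoldt n * real n powr (-\<sigma>) * (3 + 4 * cos (t * ln n) + cos (2 * (t * ln n)))"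
      by (simp add: algebra_simps)
    then show ?thesis using three_four_one[of "t * ln n"] mangoldt_nonneg[of n] by simp
  qed
  show ?thesis by (rule sums_le[OF nn sums_zero S'])
qed

text \<open>
  Approaching the line \<open>Re s = 1\<close> horizontally, the growth of \<open>mangoldt_series\<close> records the pole of
  zeta at 1 and the order of a zero of \<open>zeta_reg\<close>.
\<close>

lemma mangoldt_series_pole:
  fixes t :: real
  obtains k :: nat where "zeta_reg (Complex 1 t) = 0 \<longleftrightarrow> k > 0"
    "((\<lambda>\<delta>. \<delta> * Re (mangoldt_series (Complex (1 + \<delta>) t))) \<longlongrightarrow> (if t = 0 then 1 else 0) - real k) (at_right 0)"
proof -
  let ?s = "Complex 1 t"
  obtain k :: nat where k: "zeta_reg ?s = 0 \<longleftrightarrow> k > 0"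
    "((\<lambda>\<delta>. of_real \<delta> * (deriv zeta_reg (?s + of_real \<delta>) / zeta_reg (?s + of_real \<delta>)))
        \<longlongrightarrow> of_nat k) (at_right 0)"
    "eventually (\<lambda>\<delta>. zeta_reg (?s + of_real \<delta>) \<noteq> 0) (at_right 0)"
    using zeta_reg_order[of ?s] by auto
  have c: "?s + of_real \<delta> = Complex (1 + \<delta>) t" for \<delta> by (simp add: complex_eq_iff)
  have pole: "((\<lambda>\<delta>. Re (of_real \<delta> / (Complex (1 + \<delta>) t - 1))) \<longlongrightarrow> (if t = 0 then 1 else 0)) (at_right 0)"
  proof (cases "t = 0")
    case True
    have "eventually (\<lambda>\<delta>. 1 = Re (of_real \<delta> / (Complex (1 + \<delta>) t - 1))) (at_right 0)"
      using eventually_at_right_less[of "0::real"]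
    proof eventually_elim
      case (elim \<delta>)
      have "Complex (1 + \<delta>) t - 1 = of_real \<delta>" using True by (simp add: complex_eq_iff)
      with elim show ?case by simp
    qed
    then show ?thesis using True by (auto intro: tendsto_eventually elim: eventually_mono)
  next
    case False
    have "Complex 0 t \<noteq> 0" using False by (simp add: complex_eq_iff)
    then have "((\<lambda>\<delta>. Re (of_real \<delta> / (Complex 0 t + of_real \<delta>))) \<longlongrightarrow> Re (of_real 0 / (Complex 0 t + of_real 0))) (at_right 0)"
      by (intro tendsto_intros) auto
    moreover have "Complex (1 + \<delta>) t - 1 = Complex 0 t + of_real \<delta>" for \<delta>
      by (simp add: complex_eq_iff)
    ultimately show ?thesis using False by simp
  qed
  have "((\<lambda>\<delta>. Re (of_real \<delta> / (Complex (1 + \<delta>) t - 1))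
      - Re (of_real \<delta> * (deriv zeta_reg (?s + of_real \<delta>) / zeta_reg (?s + of_real \<delta>))))
      \<longlongrightarrow> (if t = 0 then 1 else 0) - Re (of_nat k)) (at_right 0)"
    by (intro tendsto_diff pole tendsto_Re k(2))
  moreover have "eventually (\<lambda>\<delta>. Re (of_real \<delta> / (Complex (1 + \<delta>) t - 1))
      - Re (of_real \<delta> * (deriv zeta_reg (?s + of_real \<delta>) / zeta_reg (?s + of_real \<delta>)))
      = \<delta> * Re (mangoldt_series (Complex (1 + \<delta>) t))) (at_right 0)"
    using eventually_at_right_less[of "0::real"]
  proof eventually_elim
    case (elim \<delta>)
    have "zeta_reg (?s + of_real \<delta>) \<noteq> 0" by (rule zeta_reg_nonzero_gt_1) (use elim in simp)
    then have "deriv zeta_reg (?s + of_real \<delta>) / zeta_reg (?s + of_real \<delta>)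
       = 1 / (?s + of_real \<delta> - 1) - mangoldt_series (?s + of_real \<delta>)"
      by (intro logderiv_zeta_reg) (use elim in auto)
    then show ?case
      unfolding c by (simp add: right_diff_distrib)
  qed
  ultimately have "((\<lambda>\<delta>. \<delta> * Re (mangoldt_series (Complex (1 + \<delta>) t)))
      \<longlongrightarrow> (if t = 0 then 1 else 0) - Re (of_nat k)) (at_right 0)"
    by (rule Lim_transform_eventually)
  then show ?thesis using that[OF k(1)] by simp
qed

text \<open>
  The argument of de la Vallee Poussin and Mertens: with \<open>k1\<close> and \<open>k2\<close> the orders at \<open>1 + i t\<close> and
  \<open>1 + 2 i t\<close>, the positivity of \<open>3 + 4 cos x + cos (2 x)\<close> forces \<open>3 - 4 k1 - k2 \<ge> 0\<close>, hence \<open>k1 = 0\<close>.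
\<close>

lemma zeta_reg_nonzero:
  assumes "Re s \<ge> 1"
  shows "zeta_reg s \<noteq> 0"
proof (cases "Re s > 1")
  case True
  then show ?thesis by (rule zeta_reg_nonzero_gt_1)
next
  case False
  define t where "t = Im s"
  have s: "s = Complex 1 t" using False assms by (simp add: t_def complex_eq_iff)
  show ?thesis
  proof (cases "t = 0")
    case True
    then show ?thesis using s by (simp flip: one_complex.code)
  next
    case t: False
    obtain k0 :: nat where k0: "zeta_reg (Complex 1 0) = 0 \<longleftrightarrow> k0 > 0"
      "((\<lambda>\<delta>. \<delta> * Re (mangoldt_series (Complex (1 + \<delta>) 0))) \<longlongrightarrow> 1 - real k0) (at_right 0)"
      using mangoldt_series_pole[of 0] by auto
    obtain k1 :: nat where k1: "zeta_reg (Complex 1 t) = 0 \<longleftrightarrow> k1 > 0"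
      "((\<lambda>\<delta>. \<delta> * Re (mangoldt_series (Complex (1 + \<delta>) t))) \<longlongrightarrow> 0 - real k1) (at_right 0)"
      using mangoldt_series_pole[of t] t by auto
    obtain k2 :: nat where k2:
      "((\<lambda>\<delta>. \<delta> * Re (mangoldt_series (Complex (1 + \<delta>) (2 * t)))) \<longlongrightarrow> 0 - real k2) (at_right 0)"
      using mangoldt_series_pole[of "2 * t"] t by auto
    have "k0 = 0" using k0(1) by (simp flip: one_complex.code)
    have "3 * (1 - real k0) + 4 * (0 - real k1) + (0 - real k2) \<ge> 0"
    proof (rule tendsto_lowerbound)
      show "((\<lambda>\<delta>. 3 * (\<delta> * Re (mangoldt_series (Complex (1 + \<delta>) 0)))
          + 4 * (\<delta> * Re (mangoldt_series (Complex (1 + \<delta>) t)))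
          + \<delta> * Re (mangoldt_series (Complex (1 + \<delta>) (2 * t))))
        \<longlongrightarrow> 3 * (1 - real k0) + 4 * (0 - real k1) + (0 - real k2)) (at_right 0)"
        by (intro tendsto_add tendsto_mult_left k0(2) k1(2) k2)
      show "eventually (\<lambda>\<delta>. 0 \<le> 3 * (\<delta> * Re (mangoldt_series (Complex (1 + \<delta>) 0)))
          + 4 * (\<delta> * Re (mangoldt_series (Complex (1 + \<delta>) t)))
          + \<delta> * Re (mangoldt_series (Complex (1 + \<delta>) (2 * t)))) (at_right (0::real))"
        using eventually_at_right_less[of "0::real"]
      proof eventually_elim
        case (elim \<delta>)
        have "0 \<le> \<delta> * (3 * Re (mangoldt_series (Complex (1 + \<delta>) 0))
          + 4 * Re (mangoldt_series (Complex (1 + \<delta>) t))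
          + Re (mangoldt_series (Complex (1 + \<delta>) (2 * t))))"
          using elim by (intro mult_nonneg_nonneg Re_mangoldt_series_341) auto
        then show ?case by (simp add: algebra_simps)
      qed
    qed auto
    then have "real k1 < 1" using \<open>k0 = 0\<close> by simp
    then have "k1 = 0" by simp
    then show ?thesis using k1(1) s by simp
  qed
qed

text \<open>
  Subtracting zeta rather than \<open>1 / (s - 1)\<close> removes the same pole, but keeps everything a Dirichlet
  series: the primes are then compared with all integers, term by term, and no integral transform of
  the main term is needed.
\<close>

lemma mangoldt_minus_zeta_extends:
  obtains G S where "open S" "{s. Re s \<ge> 1} \<subseteq> S" "G holomorphic_on S"
    "\<And>s. Re s > 1 \<Longrightarrow> G s = mangoldt_series s - zeta s"
proof -
  define S where "S = {s. Re s > 0} \<inter> zeta_reg -` (- {0})"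
  have H: "open {s::complex. Re s > 0}" by (rule open_halfspace_Re_gt)
  have "open S"
    unfolding S_def using zeta_reg_holomorphic H
    by (intro continuous_open_preimage holomorphic_on_imp_continuous_on) auto
  have sub: "{s. Re s \<ge> 1} \<subseteq> S"
    using zeta_reg_nonzero by (auto simp: S_def)
  define Q where "Q s = (if s = 1 then deriv zeta_reg 1 else (zeta_reg s - zeta_reg 1) / (s - 1))" for s
  have "Q holomorphic_on {s. Re s > 0}"
    unfolding Q_def using pole_theorem[of zeta_reg "{s. Re s > 0}" 1 ] zeta_reg_holomorphic H
    by (intro pole_lemma_open) auto
  then have Q: "Q holomorphic_on S" by (rule holomorphic_on_subset) (auto simp: S_def)
  have Z: "zeta_reg holomorphic_on S"
    by (rule holomorphic_on_subset[OF zeta_reg_holomorphic]) (auto simp: S_def)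
  define G where "G s = - (deriv zeta_reg s / zeta_reg s) - Q s" for s
  have "deriv zeta_reg holomorphic_on S"
    using Z \<open>open S\<close> by (rule holomorphic_deriv)
  then have "G holomorphic_on S"
    unfolding G_def using Q Z by (intro holomorphic_intros) (use \<open>open S\<close> in \<open>auto simp: S_def\<close>)
  moreover have "G s = mangoldt_series s - zeta s" if s: "Re s > 1" for s
  proof -
    have "s - 1 \<noteq> 0" using s by auto
    then have "Q s = zeta s - 1 / (s - 1)"
      using zeta_reg_eq[OF s] by (auto simp: Q_def diff_divide_distrib)
    then show ?thesis
      using logderiv_zeta_reg[OF s] zeta_reg_nonzero[of s] s by (simp add: G_def)
  qed
  ultimately show ?thesis using that \<open>open S\<close> sub by blast
qed

section \<open>The Fejer kernel\<close>

text \<open>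
  The Fourier transform of a triangle, that is, the Fejer kernel up to scaling. The compact
  support of the triangle confines the use of the zeta function to a bounded piece of the
  line \<open>Re s = 1\<close>; the kernel itself is nonnegative and concentrated near 0 at scale \<open>1 / L\<close>.
\<close>

definition fejer :: "real \<Rightarrow> real \<Rightarrow> real" where
  "fejer L u = 2 * integral {0..L} (\<lambda>t. (1 - t / L) * cos (t * u))"

lemma fejer_integrable: "(\<lambda>t::real. (1 - t / L) * cos (t * u)) integrable_on {0..L}"
  unfolding divide_inverse by (intro integrable_continuous_real continuous_intros)

lemma integral_triangle:
  assumes "L > (0::real)"
  shows "((\<lambda>t. 1 - t / L) has_integral (L / 2)) {0..L}"
proof -
  have "((\<lambda>t. 1 - t / L) has_integral ((L - L\<^sup>2 / (2 * L)) - (0 - 0\<^sup>2 / (2 * L)))) {0..L}"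
    using assms
    by (intro fundamental_theorem_of_calculus)
      (auto intro!: derivative_eq_intros simp flip: has_real_derivative_iff_has_vector_derivative)
  then show ?thesis using assms by (simp add: power2_eq_square)
qed

lemma fejer_eq:
  assumes "L > 0" "u \<noteq> 0"
  shows "fejer L u = 2 * (1 - cos (L * u)) / (L * u\<^sup>2)"
proof -
  let ?F = "\<lambda>t. (1 - t / L) * sin (t * u) / u - cos (t * u) / (L * u\<^sup>2)"
  have "((\<lambda>t. (1 - t / L) * cos (t * u)) has_integral (?F L - ?F 0)) {0..L}"
  proof (rule fundamental_theorem_of_calculus)
    fix t
    show "(?F has_vector_derivative (1 - t / L) * cos (t * u)) (at t within {0..L})"
      unfolding has_real_derivative_iff_has_vector_derivative[symmetric]
      using assms by (auto intro!: derivative_eq_intros simp: field_simps power2_eq_square)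
  qed (use assms in auto)
  moreover have "?F L - ?F 0 = (1 - cos (L * u)) / (L * u\<^sup>2)"
    using assms by (simp add: field_simps)
  ultimately show ?thesis by (simp add: fejer_def integral_unique)
qed

lemma fejer_le:
  assumes "L > 0"
  shows "fejer L u \<le> L"
proof -
  have "integral {0..L} (\<lambda>t. (1 - t / L) * cos (t * u)) \<le> L / 2"
  proof (rule has_integral_le[OF integrable_integral[OF fejer_integrable] integral_triangle[OF assms]])
    fix t assume "t \<in> {0..L}"
    then show "(1 - t / L) * cos (t * u) \<le> 1 - t / L"
      using assms by (intro mult_left_le) auto
  qed
  then show ?thesis by (simp add: fejer_def)
qed

text \<open>
  On this range all the cosines in the integral are at least \<open>cos (pi / 3)\<close>.
\<close>

lemma fejer_ge:
  assumes "L > 0" "\<bar>u\<bar> \<le> 1 / L"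
  shows "fejer L u \<ge> L / 2"
proof -
  have "L / 2 * (1 / 2) \<le> integral {0..L} (\<lambda>t. (1 - t / L) * cos (t * u))"
  proof (rule has_integral_le[OF has_integral_mult_left[OF integral_triangle[OF assms(1)]]
        integrable_integral[OF fejer_integrable]])
    fix t assume t: "t \<in> {0..L}"
    have "\<bar>t * u\<bar> \<le> L * (1 / L)"
      unfolding abs_mult using t assms by (intro mult_mono) auto
    then have "\<bar>t * u\<bar> \<le> pi / 3" using assms pi_gt3 by simp
    then have "cos (pi / 3) \<le> cos \<bar>t * u\<bar>"
      by (intro cos_monotone_0_pi_le) auto
    then have "1 / 2 \<le> cos (t * u)" by (simp add: cos_60)
    then show "(1 - t / L) * (1 / 2) \<le> (1 - t / L) * cos (t * u)"
      using t assms by (intro mult_left_mono) auto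
  qed
  then show ?thesis by (simp add: fejer_def)
qed

lemma fejer_nonneg: "L > 0 \<Longrightarrow> fejer L u \<ge> 0"
  using fejer_eq[of L u] fejer_ge[of L u] by (cases "u = 0") auto

lemma cos_bounds:
  fixes x :: real
  shows "0 \<le> 2 * (1 - cos x)" "0 \<le> 2 * (1 + cos x)" "2 * (1 - cos x) \<le> 4"
  using cos_ge_minus_one[of x] cos_le_one[of x] by - argo+

lemma fejer_far:
  assumes "L > 0" "u \<noteq> 0"
  shows "fejer L u \<le> 4 / (L * u\<^sup>2)"
proof -
  show ?thesis
    unfolding fejer_eq[OF assms] using assms by (intro divide_right_mono cos_bounds) auto
qed

lemma fejer_1_le: "fejer 1 u \<le> 8 / (1 + u\<^sup>2)"
proof (cases "\<bar>u\<bar> \<le> 1")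
  case True
  then have "u\<^sup>2 \<le> 1" by (simp add: abs_square_le_1)
  then have "1 \<le> 8 / (1 + u\<^sup>2)" by (simp add: field_simps add_pos_nonneg)
  then show ?thesis using fejer_le[of 1 u] by simp
next
  case False
  then have u: "u \<noteq> 0" "1 \<le> u\<^sup>2" by (auto simp: abs_le_square_iff[of 1, simplified, symmetric] not_le)
  then have "4 / (1 * u\<^sup>2) \<le> 8 / (1 + u\<^sup>2)" by (simp add: field_simps add_pos_nonneg)
  then show ?thesis using fejer_far[of 1 u] u by simp
qed

text \<open>
  The zeros of the two shifted kernels do not coincide, so together they dominate a Cauchy kernel.
  Bounds for the Fejer kernel thereby turn into bounds with a weight that has no zeros.
\<close>

lemma fejer_1_pair: "1 / (1 + u\<^sup>2) \<le> 8 * (fejer 1 u + fejer 1 (u + pi))"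
proof (cases "u = 0 \<or> u + pi = 0")
  case True
  have *: "8 * fejer 1 0 \<ge> 1" using fejer_ge[of 1 0] by simp
  have "1 / (1 + u\<^sup>2) \<le> 1" by (simp add: field_simps add_pos_nonneg)
  moreover have "1 \<le> 8 * (fejer 1 u + fejer 1 (u + pi))"
    using True * fejer_nonneg[of 1 u] fejer_nonneg[of 1 "u + pi"] by auto
  ultimately show ?thesis by linarith
next
  case False
  let ?M = "32 * (1 + u\<^sup>2)"
  have M0: "?M > 0" by (simp add: add_pos_nonneg)
  have "(u + pi)\<^sup>2 \<le> 2 * u\<^sup>2 + 2 * pi\<^sup>2"
    using zero_le_power2[of "u - pi"] by (simp add: power2_eq_square algebra_simps)
  moreover have "pi\<^sup>2 \<le> 4\<^sup>2" using pi_less_4 by (intro power_mono) auto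
  ultimately have M: "(u + pi)\<^sup>2 \<le> ?M" by (simp add: algebra_simps) (smt (verit) zero_le_power2)
  have "2 * (1 - cos u) / ?M + 2 * (1 + cos u) / ?M \<le> 2 * (1 - cos u) / u\<^sup>2 + 2 * (1 + cos u) / (u + pi)\<^sup>2"
    using False M
    by (intro add_mono divide_left_mono cos_bounds) (auto simp: add_pos_nonneg)
  also have "\<dots> = fejer 1 u + fejer 1 (u + pi)"
    using False by (simp add: fejer_eq)
  finally have "2 * (1 - cos u) / ?M + 2 * (1 + cos u) / ?M \<le> fejer 1 u + fejer 1 (u + pi)" .
  moreover have "2 * (1 - cos u) / ?M + 2 * (1 + cos u) / ?M = 4 / ?M"
    by (simp flip: add_divide_distrib)
  ultimately have "8 * (4 / ?M) \<le> 8 * (fejer 1 u + fejer 1 (u + pi))" by simp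
  moreover have "8 * (4 / ?M) = 1 / (1 + u\<^sup>2)"
    using M0 by (simp add: field_simps)
  ultimately show ?thesis by simp
qed

text \<open>
  One integration by parts bounds the integral by a constant over \<open>T\<close>.
\<close>

lemma riemann_lebesgue:
  fixes f f' :: "real \<Rightarrow> complex"
  assumes ab: "a \<le> b"
    and f: "\<And>t. t \<in> {a..b} \<Longrightarrow> (f has_vector_derivative f' t) (at t within {a..b})"
    and f': "continuous_on {a..b} f'"
  shows "((\<lambda>T. integral {a..b} (\<lambda>t. exp (- \<i> * of_real (T * t)) * f t)) \<longlongrightarrow> 0) at_top"
proof -
  have "bounded (f' ` {a..b})"
    using f' by (intro compact_imp_bounded compact_continuous_image) auto
  then obtain M where M: "norm (f' t) \<le> M" if "t \<in> {a..b}" for t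
    unfolding bounded_iff by blast
  define C where "C = norm (f b) + norm (f a) + M * (b - a)"
  have bound: "norm (integral {a..b} (\<lambda>t. exp (- \<i> * of_real (T * t)) * f t)) \<le> C / T" if T: "T > 0" for T
  proof -
    let ?e = "\<lambda>t. exp (- \<i> * of_real (T * t))"
    have ne: "norm (?e t) = 1" for t by (simp add: norm_exp_eq_Re)
    define F where "F t = ?e t * f t / (- \<i> * of_real T)" for t
    have "((\<lambda>t. ?e t * f t + ?e t * f' t / (- \<i> * of_real T)) has_integral (F b - F a)) {a..b}"
    proof (rule fundamental_theorem_of_calculus[OF ab])
      fix t assume t: "t \<in> {a..b}"
      have e: "(?e has_vector_derivative (- \<i> * of_real T * ?e t)) (at t within {a..b})"
        unfolding of_real_mult
        by (rule has_vector_derivative_real_field[of "\<lambda>z. exp (- \<i> * (of_real T * z))"])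
          (auto intro!: derivative_eq_intros)
      show "(F has_vector_derivative ?e t * f t + ?e t * f' t / (- \<i> * of_real T)) (at t within {a..b})"
        unfolding F_def
        by (rule has_vector_derivative_eq_rhs[OF has_vector_derivative_divide[OF has_vector_derivative_mult[OF e f[OF t]]]])
          (use T in \<open>simp add: field_simps\<close>)
    qed
    moreover have i': "(\<lambda>t. ?e t * f' t / (- \<i> * of_real T)) integrable_on {a..b}"
      using T by (intro integrable_continuous_real continuous_intros f') auto
    ultimately have "((\<lambda>t. (?e t * f t + ?e t * f' t / (- \<i> * of_real T)) - ?e t * f' t / (- \<i> * of_real T))
        has_integral (F b - F a - integral {a..b} (\<lambda>t. ?e t * f' t / (- \<i> * of_real T)))) {a..b}"
      by (intro has_integral_diff integrable_integral)
    then have eq: "integral {a..b} (\<lambda>t. ?e t * f t)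
        = F b - F a - integral {a..b} (\<lambda>t. ?e t * f' t / (- \<i> * of_real T))"
      by (simp add: integral_unique)
    have "norm (integral {a..b} (\<lambda>t. ?e t * f' t / (- \<i> * of_real T))) \<le> M / T * (b - a)"
    proof (rule integral_bound[OF ab])
      show "continuous_on {a..b} (\<lambda>t. ?e t * f' t / (- \<i> * of_real T))"
        using T by (intro continuous_intros f') auto
      show "norm (?e t * f' t / (- \<i> * of_real T)) \<le> M / T" if "t \<in> {a..b}" for t
        using T M[OF that] ne[of t] by (simp add: norm_mult norm_divide divide_right_mono)
    qed
    moreover have "norm (F t) = norm (f t) / T" for t
      using T ne[of t] by (simp add: F_def norm_mult norm_divide)
    ultimately have "norm (integral {a..b} (\<lambda>t. ?e t * f t)) \<le> norm (f b) / T + norm (f a) / T + M / T * (b - a)"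
      unfolding eq by (smt (verit) norm_triangle_ineq4)
    also have "\<dots> = C / T" by (simp add: C_def add_divide_distrib)
    finally show ?thesis .
  qed
  show ?thesis
  proof (rule Lim_null_comparison)
    show "eventually (\<lambda>T. norm (integral {a..b} (\<lambda>t. exp (- \<i> * of_real (T * t)) * f t)) \<le> C / T) at_top"
      using eventually_gt_at_top[of 0] by eventually_elim (rule bound)
    show "((\<lambda>T. C / T) \<longlongrightarrow> 0) at_top"
      by (intro tendsto_divide_0[OF tendsto_const] filterlim_at_top_imp_at_infinity filterlim_ident)
  qed
qed

section \<open>Primes against integers, weighted by the Fejer kernel\<close>

lemma Re_twist_powr:
  assumes "n > 0"
  shows "Re (exp (- \<i> * of_real (T * t)) * of_nat n powr (- Complex (1 + \<delta>) (- t)))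
    = real n powr (- 1 - \<delta>) * cos (t * (ln (real n) - T))"
proof -
  have "exp (- \<i> * of_real (T * t)) * of_nat n powr (- Complex (1 + \<delta>) (- t))
      = exp (- \<i> * of_real (T * t) + - Complex (1 + \<delta>) (- t) * of_real (ln (real n)))"
    using assms by (subst exp_add) (simp add: powr_def Ln_of_nat)
  also have "- \<i> * of_real (T * t) + - Complex (1 + \<delta>) (- t) * of_real (ln (real n))
      = Complex (- (1 + \<delta>) * ln (real n)) (t * (ln (real n) - T))"
    by (simp add: complex_eq_iff algebra_simps)
  finally show ?thesis using assms by (simp add: Re_exp powr_def algebra_simps)
qed

text \<open>
  The coefficients of \<open>mangoldt_series - zeta\<close>; the case distinction only makes the term at 0
  vanish.
\<close>

definition prime_defect :: "nat \<Rightarrow> real" where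
  "prime_defect n = mangoldt n - (if n = 0 then 0 else 1)"

lemma summable_prime_defect:
  assumes "\<sigma> > 1"
  shows "summable (\<lambda>n. \<bar>prime_defect n\<bar> * real n powr (-\<sigma>))"
proof (rule summable_comparison_test')
  have "summable (\<lambda>n. real n powr (-\<sigma>))" using assms by (simp add: summable_real_powr_iff)
  then show "summable (\<lambda>n. mangoldt n * real n powr (-\<sigma>) + real n powr (-\<sigma>))"
    by (intro summable_add summable_mangoldt_powr assms)
  show "norm (\<bar>prime_defect n\<bar> * real n powr (-\<sigma>)) \<le> mangoldt n * real n powr (-\<sigma>) + real n powr (-\<sigma>)" for n
  proof -
    have "\<bar>prime_defect n\<bar> \<le> mangoldt n + 1"
      using mangoldt_nonneg[of n] by (auto simp: prime_defect_def)
    then have "\<bar>prime_defect n\<bar> * real n powr (-\<sigma>) \<le> (mangoldt n + 1) * real n powr (-\<sigma>)"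
      by (intro mult_right_mono) auto
    then show ?thesis by (simp add: abs_mult distrib_right)
  qed
qed

lemma prime_defect_cos_sums:
  assumes G: "\<And>s. Re s > 1 \<Longrightarrow> G s = mangoldt_series s - zeta s" and \<delta>: "\<delta> > 0"
  shows "(\<lambda>n. prime_defect n * real n powr (- 1 - \<delta>) * cos (t * (ln (real n) - T)))
    sums Re (exp (- \<i> * of_real (T * t)) * G (Complex (1 + \<delta>) (- t)))"
proof -
  let ?s = "Complex (1 + \<delta>) (- t)"
  have s: "Re ?s > 1" using \<delta> by simp
  let ?e = "exp (- \<i> * of_real (T * t))"
  have "(\<lambda>n. ?e * (mangoldt n * of_nat n powr (- ?s) - of_nat n powr (- ?s))) sums (?e * G ?s)"
    unfolding G[OF s] by (intro sums_mult sums_diff mangoldt_series_sums(1) zeta_sums s)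
  then have "(\<lambda>n. Re (?e * (mangoldt n * of_nat n powr (- ?s) - of_nat n powr (- ?s)))) sums Re (?e * G ?s)"
    by (rule sums_Re)
  moreover have "Re (?e * (mangoldt n * of_nat n powr (- ?s) - of_nat n powr (- ?s)))
      = prime_defect n * real n powr (- 1 - \<delta>) * cos (t * (ln (real n) - T))" for n
  proof (cases "n = 0")
    case False
    have "?e * (mangoldt n * of_nat n powr (- ?s) - of_nat n powr (- ?s))
        = of_real (prime_defect n) * (?e * of_nat n powr (- ?s))"
      using False by (simp add: prime_defect_def algebra_simps)
    then show ?thesis using Re_twist_powr[of n T t \<delta>] False
      by (simp only: Re_complex_of_real Im_complex_of_real times_complex.sel mult_zero_left diff_0_right mult.assoc)
  qed auto
  ultimately show ?thesis by simp
qed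

text \<open>
  For \<open>\<delta> > 0\<close> this is the sum of \<open>prime_defect n * n powr (- 1 - \<delta>)\<close> against the kernel centred at
  \<open>T\<close>. The integral, unlike the series, makes sense for \<open>\<delta> = 0\<close> as well.
\<close>

definition fejer_error :: "(complex \<Rightarrow> complex) \<Rightarrow> real \<Rightarrow> real \<Rightarrow> real \<Rightarrow> real" where
  "fejer_error G L T \<delta> = 2 * integral {0..L} (\<lambda>t. (1 - t / L) *
      Re (exp (- \<i> * of_real (T * t)) * G (Complex (1 + \<delta>) (- t))))"

text \<open>
  The series under the integral converges uniformly, so it may be integrated term by term.
\<close>

lemma prime_defect_fejer_sums:
  assumes G: "\<And>s. Re s > 1 \<Longrightarrow> G s = mangoldt_series s - zeta s" and \<delta>: "\<delta> > 0" and L: "L > 0"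
  shows "(\<lambda>n. prime_defect n * real n powr (- 1 - \<delta>) * fejer L (ln (real n) - T)) sums fejer_error G L T \<delta>"
proof -
  let ?c = "\<lambda>n. prime_defect n * real n powr (- 1 - \<delta>)"
  let ?h = "\<lambda>n t. (1 - t / L) * (?c n * cos (t * (ln (real n) - T)))"
  let ?F = "\<lambda>t. (1 - t / L) * Re (exp (- \<i> * of_real (T * t)) * G (Complex (1 + \<delta>) (- t)))"
  have sm: "summable (\<lambda>n. \<bar>?c n\<bar>)"
    using summable_prime_defect[of "1 + \<delta>"] \<delta> by (simp add: abs_mult)
  have "uniform_limit {0..L} (\<lambda>N t. \<Sum>n<N. ?h n t) (\<lambda>t. \<Sum>n. ?h n t) sequentially"
  proof (rule Weierstrass_m_test[OF _ sm])
    fix n t assume t: "t \<in> {0..L}"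
    have "\<bar>1 - t / L\<bar> * (\<bar>?c n\<bar> * \<bar>cos (t * (ln (real n) - T))\<bar>) \<le> 1 * (\<bar>?c n\<bar> * 1)"
      using t L by (intro mult_mono) auto
    then show "norm (?h n t) \<le> \<bar>?c n\<bar>" by (simp add: abs_mult)
  qed
  moreover have "(\<Sum>n. ?h n t) = ?F t" for t
    using sums_mult[OF prime_defect_cos_sums[OF G \<delta>, of t T], of "1 - t / L"]
    by (simp add: sums_iff)
  ultimately have ul: "uniform_limit {0..L} (\<lambda>N t. \<Sum>n<N. ?h n t) ?F sequentially" by simp
  have hint: "?h n integrable_on {0..L}" for n
    using L by (intro integrable_continuous_real continuous_intros) auto
  obtain I J where IJ: "\<And>N. ((\<lambda>t. \<Sum>n<N. ?h n t) has_integral I N) {0..L}"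
      "(?F has_integral J) {0..L}" "I \<longlonglongrightarrow> J"
  proof (rule uniform_limit_integral[OF ul])
    show "continuous_on {0..L} (\<lambda>t. \<Sum>n<N. ?h n t)" for N
      using L by (intro continuous_intros) auto
  qed auto
  have "2 * I N = (\<Sum>n<N. ?c n * fejer L (ln (real n) - T))" for N
  proof -
    have "I N = integral {0..L} (\<lambda>t. \<Sum>n<N. ?h n t)" by (rule integral_unique[OF IJ(1), symmetric])
    also have "\<dots> = (\<Sum>n<N. integral {0..L} (?h n))"
      by (intro integral_sum hint) auto
    also have "\<dots> = (\<Sum>n<N. ?c n * integral {0..L} (\<lambda>t. (1 - t / L) * cos (t * (ln (real n) - T))))"
      by (intro sum.cong refl, subst integral_mult_right[symmetric])
        (simp_all only: mult.left_commute)
    finally show ?thesis by (simp add: fejer_def sum_distrib_left mult_ac)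
  qed
  moreover have "(\<lambda>N. 2 * I N) \<longlonglongrightarrow> 2 * J" by (intro tendsto_intros IJ)
  moreover have "2 * J = fejer_error G L T \<delta>" using IJ(2) by (simp add: fejer_error_def integral_unique)
  ultimately show ?thesis unfolding sums_def by simp
qed

lemma fejer_error_continuous:
  assumes S: "{s. Re s \<ge> 1} \<subseteq> S" and G: "G holomorphic_on S" and L: "L > 0"
  shows "(fejer_error G L T \<longlongrightarrow> fejer_error G L T 0) (at_right 0)"
proof -
  have Gc: "continuous_on {s. Re s \<ge> 1} G"
    using holomorphic_on_imp_continuous_on[OF holomorphic_on_subset[OF G S]] .
  have "continuous_on ({0..1} \<times> cbox 0 L) (\<lambda>x. G (Complex (1 + fst x) (- snd x)))"
    unfolding complex_eq
    by (rule continuous_on_compose2[OF Gc]) (auto intro!: continuous_intros)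
  then have "continuous_on {0..1} (\<lambda>\<delta>. integral (cbox 0 L) (\<lambda>t. (1 - t / L) *
      Re (exp (- \<i> * of_real (T * t)) * G (Complex (1 + \<delta>) (- t)))))"
    using L by (intro integral_continuous_on_param)
      (auto intro!: continuous_intros simp: case_prod_unfold)
  then have "continuous_on {0..1} (fejer_error G L T)"
    unfolding fejer_error_def by (intro continuous_intros) simp
  then have "(fejer_error G L T \<longlongrightarrow> fejer_error G L T 0) (at 0 within {0..1})"
    by (simp add: continuous_on_def)
  then show ?thesis
    by (simp add: at_within_Icc_at_right)
qed

lemma fejer_error_tendsto_0:
  assumes "open S" and S: "{s. Re s \<ge> 1} \<subseteq> S" and G: "G holomorphic_on S" and L: "L > 0"
  shows "((\<lambda>T. fejer_error G L T 0) \<longlongrightarrow> 0) at_top"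
proof -
  let ?z = "\<lambda>t. Complex 1 (- t)"
  let ?f = "\<lambda>t. of_real (1 - t / L) * G (?z t)"
  let ?f' = "\<lambda>t. of_real (1 - t / L) * (- \<i> * deriv G (?z t)) + of_real (- 1 / L) * G (?z t)"
  have zS: "?z t \<in> S" for t using S by auto
  have z: "(?z has_vector_derivative - \<i>) (at t within {0..L})" for t
  proof -
    have "((\<lambda>t. 1 - \<i> * of_real t) has_vector_derivative - \<i>) (at t within {0..L})"
      by (rule has_vector_derivative_real_field[of "\<lambda>z. 1 - \<i> * z"]) (auto intro!: derivative_eq_intros)
    moreover have "1 - \<i> * of_real t = ?z t" for t by (simp add: complex_eq_iff)
    ultimately show ?thesis by simp
  qed
  have Gz: "((\<lambda>t. G (?z t)) has_vector_derivative - \<i> * deriv G (?z t)) (at t within {0..L})" for t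
    using field_vector_diff_chain_within[OF z, of G "deriv G (?z t)"]
      has_field_derivative_at_within[OF holomorphic_derivI[OF G \<open>open S\<close> zS]]
    by (simp add: o_def)
  have Gc: "continuous_on {0..L} (\<lambda>t. g (?z t))" if "g holomorphic_on S" for g
    by (rule continuous_on_compose2[OF holomorphic_on_imp_continuous_on[OF that]])
      (use zS in \<open>auto simp: complex_eq intro!: continuous_intros\<close>)
  have "((\<lambda>T. integral {0..L} (\<lambda>t. exp (- \<i> * of_real (T * t)) * ?f t)) \<longlongrightarrow> 0) at_top"
  proof (rule riemann_lebesgue)
    show "(?f has_vector_derivative ?f' t) (at t within {0..L})" for t
    proof (rule has_vector_derivative_mult[OF _ Gz])
      show "((\<lambda>t. complex_of_real (1 - t / L)) has_vector_derivative of_real (- 1 / L)) (at t within {0..L})"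
        by (rule has_vector_derivative_of_real)
          (use L in \<open>auto intro!: derivative_eq_intros simp flip: has_real_derivative_iff_has_vector_derivative\<close>)
    qed
    show "continuous_on {0..L} ?f'"
      using L by (intro continuous_intros Gc G holomorphic_deriv \<open>open S\<close>) auto
  qed (use L in auto)
  from tendsto_mult_left[OF tendsto_Re[OF this], of 2]
  have "((\<lambda>T. 2 * Re (integral {0..L} (\<lambda>t. exp (- \<i> * of_real (T * t)) * ?f t))) \<longlongrightarrow> 0) at_top"
    by simp
  moreover have "2 * Re (integral {0..L} (\<lambda>t. exp (- \<i> * of_real (T * t)) * ?f t)) = fejer_error G L T 0" for T
  proof -
    have "(\<lambda>t. exp (- \<i> * of_real (T * t)) * ?f t) integrable_on {0..L}"
      using L by (intro integrable_continuous_real continuous_intros Gc G) auto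
    from integral_linear[OF this bounded_linear_Re]
    have "Re (integral {0..L} (\<lambda>t. exp (- \<i> * of_real (T * t)) * ?f t))
      = integral {0..L} (\<lambda>t. Re (exp (- \<i> * of_real (T * t)) * ?f t))" by (simp add: o_def)
    also have "(\<lambda>t. Re (exp (- \<i> * of_real (T * t)) * ?f t))
      = (\<lambda>t. (1 - t / L) * Re (exp (- \<i> * of_real (T * t)) * G (Complex (1 + 0) (- t))))"
    proof
      fix t
      have "exp (- \<i> * of_real (T * t)) * ?f t = of_real (1 - t / L) * (exp (- \<i> * of_real (T * t)) * G (?z t))"
        by (simp only: mult.left_commute)
      then show "Re (exp (- \<i> * of_real (T * t)) * ?f t)
        = (1 - t / L) * Re (exp (- \<i> * of_real (T * t)) * G (Complex (1 + 0) (- t)))"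
        by (simp only: add_0_right times_complex.sel Re_complex_of_real Im_complex_of_real mult_zero_left diff_0_right)
    qed
    finally show ?thesis by (simp only: fejer_error_def)
  qed
  ultimately show ?thesis by simp
qed

section \<open>Primes in short intervals\<close>

lemma powr_inverse_limit:
  "((\<lambda>\<delta>. \<Sum>n\<in>A. c n * real n powr (- 1 - \<delta>) * w n) \<longlongrightarrow> (\<Sum>n\<in>A. c n / real n * w n)) (at_right 0)"
proof (intro tendsto_sum)
  fix n :: nat
  have "((\<lambda>\<delta>. c n * real n powr (- 1 - \<delta>) * w n) \<longlongrightarrow> c n * real n powr (- 1 - 0) * w n) (at_right 0)"
    if "n > 0" using that by (intro tendsto_intros) auto
  then show "((\<lambda>\<delta>. c n * real n powr (- 1 - \<delta>) * w n) \<longlongrightarrow> c n / real n * w n) (at_right 0)"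
    by (cases "n = 0") (auto simp: powr_minus_divide)
qed

lemma powr_le_inverse: "\<delta> > 0 \<Longrightarrow> real n powr (- 1 - \<delta>) \<le> 1 / real n"
proof (cases "n = 0")
  case False
  assume "\<delta> > 0"
  then have "real n powr (- 1 - \<delta>) \<le> real n powr (- 1)" using False by (intro powr_mono) auto
  then show ?thesis using False by (simp add: powr_minus_divide)
qed auto

text \<open>
  The data from the analytic part on which the comparison of primes with integers rests.
\<close>

locale continuation =
  fixes G :: "complex \<Rightarrow> complex" and S :: "complex set"
  assumes S: "open S" "{s. Re s \<ge> 1} \<subseteq> S" and G: "G holomorphic_on S"
    and G_eq: "\<And>s. Re s > 1 \<Longrightarrow> G s = mangoldt_series s - zeta s"
begin

lemma suminf_mangoldt_fejer:
  assumes \<delta>: "\<delta> > 0" and L: "L > 0"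
  shows "summable (\<lambda>n. mangoldt n * real n powr (- 1 - \<delta>) * fejer L (ln (real n) - T))"
    and "summable (\<lambda>n. real n powr (- 1 - \<delta>) * fejer L (ln (real n) - T))"
    and "(\<Sum>n. mangoldt n * real n powr (- 1 - \<delta>) * fejer L (ln (real n) - T))
      = fejer_error G L T \<delta> + (\<Sum>n. real n powr (- 1 - \<delta>) * fejer L (ln (real n) - T))"
proof -
  let ?p = "\<lambda>n. real n powr (- 1 - \<delta>)" and ?w = "\<lambda>n::nat. fejer L (ln (real n) - T)"
  have w: "0 \<le> ?w n" "?w n \<le> L" for n using fejer_nonneg fejer_le L by auto
  have "summable (\<lambda>n. L * (mangoldt n * ?p n))"
    using summable_mangoldt_powr[of "1 + \<delta>"] \<delta> by (intro summable_mult) simp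
  then show s1: "summable (\<lambda>n. mangoldt n * ?p n * ?w n)"
  proof (rule summable_comparison_test')
    show "norm (mangoldt n * ?p n * ?w n) \<le> L * (mangoldt n * ?p n)" for n
      using w[of n] mangoldt_nonneg[of n] mult_left_mono[OF w(2)[of n], of "mangoldt n * ?p n"]
      by (simp add: abs_mult mult_ac)
  qed
  have "summable (\<lambda>n. L * ?p n)"
    using \<delta> by (intro summable_mult) (simp add: summable_real_powr_iff)
  then show s2: "summable (\<lambda>n. ?p n * ?w n)"
  proof (rule summable_comparison_test')
    show "norm (?p n * ?w n) \<le> L * ?p n" for n
      using w[of n] mult_left_mono[OF w(2)[of n], of "?p n"] by (simp add: abs_mult mult_ac)
  qed
  have "(\<lambda>n. prime_defect n * ?p n * ?w n + ?p n * ?w n) sums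
      (fejer_error G L T \<delta> + (\<Sum>n. ?p n * ?w n))"
    by (intro sums_add prime_defect_fejer_sums G_eq \<delta> L summable_sums s2)
  moreover have "prime_defect n * ?p n * ?w n + ?p n * ?w n = mangoldt n * ?p n * ?w n" for n
    by (cases "n = 0") (auto simp: prime_defect_def algebra_simps)
  ultimately show "(\<Sum>n. mangoldt n * ?p n * ?w n) = fejer_error G L T \<delta> + (\<Sum>n. ?p n * ?w n)"
    by (simp add: sums_iff)
qed

text \<open>
  Both this bound and the next one pass to \<open>\<delta> = 0\<close> through finite sums only: by nonnegativity of all
  terms, inequalities for finite sums suffice and the interchange of the limit with an infinite
  sum is avoided.
\<close>

lemma mangoldt_fejer_upper:
  assumes L: "L > 0" and A: "finite A"
    and B: "\<And>A'. finite A' \<Longrightarrow> (\<Sum>n\<in>A'. 1 / real n * fejer L (ln (real n) - T)) \<le> B"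
  shows "(\<Sum>n\<in>A. mangoldt n / real n * fejer L (ln (real n) - T)) \<le> fejer_error G L T 0 + B"
proof (rule tendsto_le)
  let ?p = "\<lambda>\<delta> n. real n powr (- 1 - \<delta>)" and ?w = "\<lambda>n::nat. fejer L (ln (real n) - T)"
  show "((\<lambda>\<delta>. \<Sum>n\<in>A. mangoldt n * ?p \<delta> n * ?w n) \<longlongrightarrow> (\<Sum>n\<in>A. mangoldt n / real n * ?w n)) (at_right 0)"
    by (rule powr_inverse_limit)
  show "((\<lambda>\<delta>. fejer_error G L T \<delta> + B) \<longlongrightarrow> fejer_error G L T 0 + B) (at_right 0)"
    by (intro tendsto_intros fejer_error_continuous[OF S(2) G L])
  show "eventually (\<lambda>\<delta>. (\<Sum>n\<in>A. mangoldt n * ?p \<delta> n * ?w n) \<le> fejer_error G L T \<delta> + B) (at_right 0)"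
    using eventually_at_right_less[of "0::real"]
  proof eventually_elim
    case (elim \<delta>)
    note s = suminf_mangoldt_fejer[OF elim L, of T]
    have w: "0 \<le> ?w n" for n using fejer_nonneg L by auto
    have "(\<Sum>n\<in>A. mangoldt n * ?p \<delta> n * ?w n) \<le> (\<Sum>n. mangoldt n * ?p \<delta> n * ?w n)"
      using w mangoldt_nonneg by (intro sum_le_suminf[OF s(1) A]) simp
    moreover have "(\<Sum>n. ?p \<delta> n * ?w n) \<le> B"
    proof (rule suminf_le_const[OF s(2)])
      fix N
      have "(\<Sum>n<N. ?p \<delta> n * ?w n) \<le> (\<Sum>n<N. 1 / real n * ?w n)"
        using w powr_le_inverse[OF elim] by (intro sum_mono mult_right_mono) auto
      also have "\<dots> \<le> B" by (rule B) simp
      finally show "(\<Sum>n<N. ?p \<delta> n * ?w n) \<le> B" .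
    qed
    ultimately show ?case using s(3) by linarith
  qed
qed simp

lemma mangoldt_fejer_lower:
  assumes L: "L > 0" and A: "finite A"
    and U: "\<And>A'. finite A' \<Longrightarrow> (\<Sum>n\<in>A'. mangoldt n / real n * fejer L (ln (real n) - T)) \<le> U"
  shows "fejer_error G L T 0 + (\<Sum>n\<in>A. 1 / real n * fejer L (ln (real n) - T)) \<le> U"
proof (rule tendsto_le[OF _ tendsto_const])
  let ?p = "\<lambda>\<delta> n. real n powr (- 1 - \<delta>)" and ?w = "\<lambda>n::nat. fejer L (ln (real n) - T)"
  show "((\<lambda>\<delta>. fejer_error G L T \<delta> + (\<Sum>n\<in>A. 1 * ?p \<delta> n * ?w n))
      \<longlongrightarrow> fejer_error G L T 0 + (\<Sum>n\<in>A. 1 / real n * ?w n)) (at_right 0)"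
    by (intro tendsto_add fejer_error_continuous[OF S(2) G L] powr_inverse_limit)
  show "eventually (\<lambda>\<delta>. fejer_error G L T \<delta> + (\<Sum>n\<in>A. 1 * ?p \<delta> n * ?w n) \<le> U) (at_right 0)"
    using eventually_at_right_less[of "0::real"]
  proof eventually_elim
    case (elim \<delta>)
    note s = suminf_mangoldt_fejer[OF elim L, of T]
    have w: "0 \<le> ?w n" for n using fejer_nonneg L by auto
    have "(\<Sum>n\<in>A. 1 * ?p \<delta> n * ?w n) \<le> (\<Sum>n. ?p \<delta> n * ?w n)"
      using w by (simp, intro sum_le_suminf[OF s(2) A]) simp
    moreover have "(\<Sum>n. mangoldt n * ?p \<delta> n * ?w n) \<le> U"
    proof (rule suminf_le_const[OF s(1)])
      fix N
      have "(\<Sum>n<N. mangoldt n * ?p \<delta> n * ?w n) \<le> (\<Sum>n<N. mangoldt n / real n * ?w n)"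
      proof (intro sum_mono mult_right_mono w)
        fix n
        show "mangoldt n * ?p \<delta> n \<le> mangoldt n / real n"
          using mult_left_mono[OF powr_le_inverse[OF elim, of n] mangoldt_nonneg[of n]] by simp
      qed
      also have "\<dots> \<le> U" by (rule U) simp
      finally show "(\<Sum>n<N. mangoldt n * ?p \<delta> n * ?w n) \<le> U" .
    qed
    ultimately show ?case using s(3) by linarith
  qed
qed simp

end

text \<open>
  The summand is, up to the factor 3, the increment of \<open>arctan (ln x - T)\<close> over \<open>[n - 1, n]\<close>, so that
  the sum telescopes.
\<close>

lemma harmonic_cauchy_bound:
  assumes A: "finite A"
  shows "(\<Sum>n\<in>A. 1 / real n * (1 / (1 + (ln (real n) - T)\<^sup>2))) \<le> 13"
proof -
  let ?f = "\<lambda>n::nat. 1 / real n * (1 / (1 + (ln (real n) - T)\<^sup>2))"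
  let ?h = "\<lambda>x. arctan (ln x - T)"
  have step: "?f n \<le> 3 * (?h (real n) - ?h (real (n - 1)))" if n: "n \<ge> 2" for n
  proof -
    have "\<exists>z. real (n - 1) < z \<and> z < real n \<and>
        ?h (real n) - ?h (real (n - 1)) = (real n - real (n - 1)) * (1 / z * (1 / (1 + (ln z - T)\<^sup>2)))"
    proof (rule MVT2)
      fix x assume "real (n - 1) \<le> x" "x \<le> real n"
      then have "x > 0" using n by (smt (verit) of_nat_0_less_iff zero_less_diff Suc_1 Suc_le_lessD)
      then show "(?h has_real_derivative 1 / x * (1 / (1 + (ln x - T)\<^sup>2))) (at x)"
        by (auto intro!: derivative_eq_intros simp: divide_inverse)
    qed (use n in auto)
    then obtain z where z: "real (n - 1) < z" "z < real n"
      and hz: "?h (real n) - ?h (real (n - 1)) = 1 / z * (1 / (1 + (ln z - T)\<^sup>2))"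
      using n by (auto simp: of_nat_diff)
    have z1: "z > 1" using z n by (simp add: of_nat_diff)
    have zn: "real n < z + 1" using z n by (simp add: of_nat_diff)
    have "ln (real n / z) \<le> real n / z - 1" using z z1 by (intro ln_le_minus_one) auto
    also have "\<dots> \<le> 1" using zn z1 by (simp add: field_simps)
    finally have "ln (real n) - ln z \<le> 1" using z z1 by (simp add: ln_div)
    moreover have "ln z \<le> ln (real n)" using z z1 by simp
    ultimately have d: "(ln z - ln (real n))\<^sup>2 \<le> 1" by (simp add: abs_square_le_1)
    define a b where "a = ln (real n) - T" and "b = ln z - ln (real n)"
    have "(a + b)\<^sup>2 \<le> 2 * a\<^sup>2 + 2 * b\<^sup>2"
      using zero_le_power2[of "a - b"] by (simp add: power2_eq_square algebra_simps)
    moreover have "b\<^sup>2 \<le> 1" using d by (simp add: b_def)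
    moreover have "a\<^sup>2 \<ge> 0" by simp
    ultimately have "1 + (a + b)\<^sup>2 \<le> 3 * (1 + a\<^sup>2)" by argo
    then have q: "1 + (ln z - T)\<^sup>2 \<le> 3 * (1 + (ln (real n) - T)\<^sup>2)"
      by (simp add: a_def b_def)
    have "z * (1 + (ln z - T)\<^sup>2) \<le> real n * (3 * (1 + (ln (real n) - T)\<^sup>2))"
      using z z1 q by (intro mult_mono) auto
    then have "1 / (real n * (3 * (1 + (ln (real n) - T)\<^sup>2))) \<le> 1 / (z * (1 + (ln z - T)\<^sup>2))"
      using z1 by (intro frac_le mult_pos_pos) (auto simp: add_pos_nonneg)
    then have "3 * (1 / (real n * (3 * (1 + (ln (real n) - T)\<^sup>2)))) \<le> 3 * (1 / (z * (1 + (ln z - T)\<^sup>2)))"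
      by (intro mult_left_mono) auto
    moreover have "3 * (1 / (x * (3 * q))) = 1 / x * (1 / q)" for x q :: real by simp
    moreover have "1 / (z * (1 + (ln z - T)\<^sup>2)) = 1 / z * (1 / (1 + (ln z - T)\<^sup>2))" by simp
    ultimately show ?thesis unfolding hz by metis
  qed
  have nn: "?f n \<ge> 0" for n by (simp add: add_nonneg_nonneg)
  \<comment> \<open>\<open>arctan (ln x - T)\<close> is not defined at 0, so the terms 0 and 1 are split off.\<close>
  have tele: "(\<Sum>n\<in>{2..<Suc (Suc N)}. ?f n) \<le> 3 * (?h (real (Suc N)) - ?h 1)" for N
  proof (induction N)
    case (Suc N)
    have "{2..<Suc (Suc (Suc N))} = insert (Suc (Suc N)) {2..<Suc (Suc N)}" by auto
    then have "(\<Sum>n\<in>{2..<Suc (Suc (Suc N))}. ?f n) = ?f (Suc (Suc N)) + (\<Sum>n\<in>{2..<Suc (Suc N)}. ?f n)"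
      by simp
    also have "\<dots> \<le> 3 * (?h (real (Suc (Suc N))) - ?h (real (Suc N))) + 3 * (?h (real (Suc N)) - ?h 1)"
      using step[of "Suc (Suc N)"] by (intro add_mono Suc.IH) (simp del: of_nat_Suc)
    finally show ?case by (simp only: right_diff_distrib)
  qed simp
  obtain N where N: "A \<subseteq> {..<N}" using A finite_nat_iff_bounded by blast
  have "(\<Sum>n\<in>A. ?f n) \<le> (\<Sum>n\<in>insert 0 (insert 1 {2..<Suc (Suc N)}). ?f n)"
    using N nn by (intro sum_mono2) force+
  also have "\<dots> = ?f 1 + (\<Sum>n\<in>{2..<Suc (Suc N)}. ?f n)" by simp
  also have "?f 1 \<le> 1" by (simp add: field_simps add_pos_nonneg)
  also have "(\<Sum>n\<in>{2..<Suc (Suc N)}. ?f n) \<le> 3 * (?h (real (Suc N)) - ?h 1)" by (rule tele)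
  also have "?h (real (Suc N)) - ?h 1 \<le> 4"
    using arctan_ubound[of "ln (real (Suc N)) - T"] arctan_lbound[of "ln 1 - T"] pi_less_4 by argo
  finally show ?thesis by simp
qed

text \<open>
  Proper prime powers below \<open>exp (T + 1)\<close> have base at most \<open>exp ((T + 1) / 2)\<close> and an exponent linear
  in \<open>T\<close>, so there are too few of them to matter.
\<close>

lemma perfect_power_mass:
  assumes T: "T \<ge> 1" and A: "finite A"
    and near: "\<And>n. n \<in> A \<Longrightarrow> \<bar>ln (real n) - T\<bar> < 1 \<and> \<not> prime n"
  shows "(\<Sum>n\<in>A. mangoldt n / real n) \<le> 2 * (T + 1)\<^sup>2 * exp (3 / 2 - T / 2)"
proof -
  let ?P = "{n \<in> A. primepow n}"
  let ?I = "{0..nat \<lfloor>exp ((T + 1) / 2)\<rfloor>} - {0}" and ?J = "{0..nat \<lfloor>2 * (T + 1)\<rfloor>} - {0}"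
  have pos: "n > 0" if "n \<in> A" for n
    using near[OF that] T by (cases "n = 0") auto
  have "?P \<subseteq> (\<lambda>(p, k). p ^ k) ` (?I \<times> ?J)"
  proof
    fix n assume n: "n \<in> ?P"
    then obtain p k where pk: "prime p" "k > 0" "n = p ^ k" by (auto simp: primepow_def)
    have "k \<noteq> 1" using near[of n] n pk by auto
    then have k: "k \<ge> 2" using pk by simp
    have p: "p \<ge> 2" using pk prime_ge_2_nat by blast
    have "ln (real n) < T + 1" using near[of n] n by auto
    then have lnn: "real k * ln (real p) \<le> T + 1"
      using pk p by (simp add: ln_realpow)
    have "2 * ln (real p) \<le> real k * ln (real p)" using k p by (intro mult_right_mono) auto
    then have "ln (real p) \<le> (T + 1) / 2" using lnn by simp
    then have p_le: "real p \<le> exp ((T + 1) / 2)" using p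
      by (metis exp_le_cancel_iff exp_ln of_nat_0_less_iff pos2 less_le_trans)
    have "real k * (1 / 2) \<le> real k * ln (real p)"
    proof (intro mult_left_mono)
      have "(1/2::real) \<le> ln 2" using ln2_ge_two_thirds by linarith
      also have "\<dots> \<le> ln (real p)" using p by simp
      finally show "1 / 2 \<le> ln (real p)" .
    qed auto
    then have "real k \<le> 2 * (T + 1)" using lnn by argo
    then have "k \<le> nat \<lfloor>2 * (T + 1)\<rfloor>" by (rule le_nat_floor)
    moreover have "p \<le> nat \<lfloor>exp ((T + 1) / 2)\<rfloor>" using p_le by (rule le_nat_floor)
    ultimately have "(p, k) \<in> ?I \<times> ?J" using p k by auto
    then show "n \<in> (\<lambda>(p, k). p ^ k) ` (?I \<times> ?J)"
      by (rule image_eqI[rotated]) (simp add: pk(3))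
  qed
  then have "card ?P \<le> card ((\<lambda>(p, k). p ^ k) ` (?I \<times> ?J))" by (intro card_mono) auto
  also have "\<dots> \<le> card (?I \<times> ?J)" by (intro card_image_le) auto
  also have "\<dots> = nat \<lfloor>exp ((T + 1) / 2)\<rfloor> * nat \<lfloor>2 * (T + 1)\<rfloor>" by (simp add: card_cartesian_product)
  finally have "real (card ?P) \<le> real (nat \<lfloor>exp ((T + 1) / 2)\<rfloor>) * real (nat \<lfloor>2 * (T + 1)\<rfloor>)"
    by (metis of_nat_le_iff of_nat_mult)
  also have "\<dots> \<le> exp ((T + 1) / 2) * (2 * (T + 1))"
    using T by (intro mult_mono of_nat_floor) auto
  finally have card: "real (card ?P) \<le> exp ((T + 1) / 2) * (2 * (T + 1))" .
  have "(\<Sum>n\<in>A. mangoldt n / real n) = (\<Sum>n\<in>?P. mangoldt n / real n)"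
    using A by (intro sum.mono_neutral_right) (auto simp: mangoldt_def)
  also have "\<dots> \<le> of_nat (card ?P) * ((T + 1) * exp (1 - T))"
  proof (rule sum_bounded_above)
    fix n assume n: "n \<in> ?P"
    have n0: "n > 0" using n pos by auto
    have l: "T - 1 < ln (real n)" "ln (real n) < T + 1" using near[of n] n by auto
    have "exp (T - 1) < real n" using l(1) n0 by (metis exp_less_mono exp_ln of_nat_0_less_iff)
    then have "1 / real n \<le> 1 / exp (T - 1)" by (intro frac_le) auto
    also have "1 / exp (T - 1) = exp (1 - T)" by (simp add: exp_diff)
    finally have inv: "1 / real n \<le> exp (1 - T)" .
    have "mangoldt n \<le> T + 1" using mangoldt_le[of n] n0 l by simp
    then have "mangoldt n * (1 / real n) \<le> (T + 1) * exp (1 - T)"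
      using T by (intro mult_mono inv) auto
    then show "mangoldt n / real n \<le> (T + 1) * exp (1 - T)" by simp
  qed
  also have "\<dots> \<le> exp ((T + 1) / 2) * (2 * (T + 1)) * ((T + 1) * exp (1 - T))"
    using T by (intro mult_right_mono card) auto
  also have "\<dots> = 2 * (T + 1)\<^sup>2 * (exp ((T + 1) / 2) * exp (1 - T))"
    by (simp add: power2_eq_square algebra_simps)
  also have "exp ((T + 1) / 2) * exp (1 - T) = exp (3 / 2 - T / 2)"
    by (simp add: field_simps flip: exp_add)
  finally show ?thesis .
qed

text \<open>
  About \<open>exp T / L\<close> integers lie between \<open>exp T\<close> and \<open>exp (T + 1 / L)\<close>, each of reciprocal about
  \<open>exp (- T)\<close>.
\<close>

lemma harmonic_window:
  assumes L: "L \<ge> 1" and T: "2 * L * exp (- T) \<le> 1"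
  obtains A where "finite A" "\<And>n. n \<in> A \<Longrightarrow> \<bar>ln (real n) - T\<bar> \<le> 1 / L" "(\<Sum>n\<in>A. 1 / real n) \<ge> 1 / (6 * L)"
proof -
  define A where "A = {n. n > 0 \<and> real n > exp T \<and> real n \<le> exp (T + 1 / L)}"
  have fin: "finite A"
    by (rule finite_subset[of _ "{..nat \<lfloor>exp (T + 1 / L)\<rfloor>}"]) (auto simp: A_def le_nat_floor)
  have near: "\<bar>ln (real n) - T\<bar> \<le> 1 / L" if "n \<in> A" for n
  proof -
    have n: "real n > 0" "exp T < real n" "real n \<le> exp (T + 1 / L)" using that by (auto simp: A_def)
    have "T < ln (real n)" using n by (metis exp_less_cancel_iff exp_ln)
    moreover have "ln (real n) \<le> T + 1 / L" using n by (metis exp_le_cancel_iff exp_ln)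
    ultimately show ?thesis by simp
  qed
  have "A \<supseteq> {nat \<lfloor>exp T\<rfloor> <.. nat \<lfloor>exp (T + 1 / L)\<rfloor>}"
  proof
    fix n assume n: "n \<in> {nat \<lfloor>exp T\<rfloor> <.. nat \<lfloor>exp (T + 1 / L)\<rfloor>}"
    then have "real n > exp T" by (simp add: floor_less_iff nat_less_iff)
    moreover have "real n \<le> exp (T + 1 / L)" using n by (simp add: le_nat_iff le_floor_iff)
    ultimately show "n \<in> A" using exp_gt_zero[of T] by (auto simp: A_def intro!: Nat.gr0I)
  qed
  then have "card {nat \<lfloor>exp T\<rfloor> <.. nat \<lfloor>exp (T + 1 / L)\<rfloor>} \<le> card A" using fin by (intro card_mono)
  then have "nat \<lfloor>exp (T + 1 / L)\<rfloor> \<le> card A + nat \<lfloor>exp T\<rfloor>" by simp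
  then have "real (nat \<lfloor>exp (T + 1 / L)\<rfloor>) \<le> real (card A) + real (nat \<lfloor>exp T\<rfloor>)"
    by (metis of_nat_add of_nat_le_iff)
  moreover have "real (nat \<lfloor>exp T\<rfloor>) \<le> exp T" by (intro of_nat_floor) simp
  moreover have "real (nat \<lfloor>exp (T + 1 / L)\<rfloor>) \<ge> exp (T + 1 / L) - 1" by linarith
  ultimately have c1: "exp (T + 1 / L) - exp T - 1 \<le> real (card A)" by linarith
  have "exp T * (1 + 1 / L) \<le> exp T * exp (1 / L)" by (intro mult_left_mono exp_ge_add_one_self) auto
  then have "exp T + exp T / L \<le> exp (T + 1 / L)" by (simp add: exp_add algebra_simps)
  then have c2: "exp T / L - 1 \<le> real (card A)" using c1 by linarith
  have "1 * exp T \<ge> (2 * L * exp (- T)) * exp T" using T by (intro mult_right_mono) auto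
  then have "2 * L \<le> exp T" by (simp add: exp_minus field_simps)
  then have "exp T / (2 * L) \<ge> 1" using L by simp
  moreover have "exp T / L = exp T / (2 * L) + exp T / (2 * L)" using L by (simp add: field_simps)
  ultimately have c3: "exp T / (2 * L) \<le> real (card A)" using c2 by linarith
  have "exp (1 / L) \<le> exp 1" using L by simp
  then have e3: "exp (1 / L) \<le> 3" using exp_le by linarith
  have "1 / (6 * L) = (exp T / (2 * L)) * (1 / (3 * exp T))" using L by simp
  also have "\<dots> \<le> real (card A) * (1 / (3 * exp T))" by (intro mult_right_mono c3) auto
  also have "\<dots> \<le> real (card A) * (1 / exp (T + 1 / L))"
  proof -
    have "exp (T + 1 / L) \<le> 3 * exp T" using e3 by (simp add: exp_add)
    then show ?thesis by (intro mult_left_mono divide_left_mono) auto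
  qed
  also have "\<dots> \<le> (\<Sum>n\<in>A. 1 / real n)"
    by (rule sum_bounded_below) (auto simp: A_def intro!: divide_left_mono)
  finally show ?thesis using that fin near by blast
qed

context continuation
begin

text \<open>
  A Chebyshev-type bound: a window of bounded logarithmic length carries bounded prime mass. It comes
  from the comparison with the integers for the kernel of width 1.
\<close>

lemma mangoldt_cauchy_bound:
  "\<exists>C T0. \<forall>T\<ge>T0. \<forall>A. finite A \<longrightarrow>
    (\<Sum>n\<in>A. mangoldt n / real n * (1 / (1 + (ln (real n) - T)\<^sup>2))) \<le> C"
proof -
  have "eventually (\<lambda>T. fejer_error G 1 T 0 < 1) at_top"
    using order_tendstoD(2)[OF fejer_error_tendsto_0[OF S G]] by simp
  then obtain T0 where T0: "\<And>T. T \<ge> T0 \<Longrightarrow> fejer_error G 1 T 0 < 1"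
    by (auto simp: eventually_at_top_linorder)
  have b: "(\<Sum>n\<in>A. mangoldt n / real n * fejer 1 (ln (real n) - T)) \<le> 105"
    if T: "T \<ge> T0" and A: "finite A" for T A
  proof -
    have "(\<Sum>n\<in>A. mangoldt n / real n * fejer 1 (ln (real n) - T)) \<le> fejer_error G 1 T 0 + 8 * 13"
    proof (rule mangoldt_fejer_upper[OF _ A])
      fix A' :: "nat set" assume A': "finite A'"
      have "(\<Sum>n\<in>A'. 1 / real n * fejer 1 (ln (real n) - T))
          \<le> (\<Sum>n\<in>A'. 8 * (1 / real n * (1 / (1 + (ln (real n) - T)\<^sup>2))))"
      proof (rule sum_mono)
        fix n
        show "1 / real n * fejer 1 (ln (real n) - T) \<le> 8 * (1 / real n * (1 / (1 + (ln (real n) - T)\<^sup>2)))"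
          using mult_left_mono[OF fejer_1_le[of "ln (real n) - T"], of "1 / real n"] by simp
      qed
      also have "\<dots> \<le> 8 * 13"
        unfolding sum_distrib_left[symmetric] by (intro mult_left_mono harmonic_cauchy_bound A') auto
      finally show "(\<Sum>n\<in>A'. 1 / real n * fejer 1 (ln (real n) - T)) \<le> 8 * 13" .
    qed simp
    then show ?thesis using T0[OF T] by linarith
  qed
  have "(\<Sum>n\<in>A. mangoldt n / real n * (1 / (1 + (ln (real n) - T)\<^sup>2))) \<le> 8 * (105 + 105)"
    if T: "T \<ge> T0 + pi" and A: "finite A" for T A
  proof -
    have "(\<Sum>n\<in>A. mangoldt n / real n * (1 / (1 + (ln (real n) - T)\<^sup>2)))
       \<le> (\<Sum>n\<in>A. 8 * (mangoldt n / real n * fejer 1 (ln (real n) - T)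
            + mangoldt n / real n * fejer 1 (ln (real n) - (T - pi))))"
    proof (rule sum_mono)
      fix n
      have "mangoldt n / real n * (1 / (1 + (ln (real n) - T)\<^sup>2))
        \<le> mangoldt n / real n * (8 * (fejer 1 (ln (real n) - T) + fejer 1 (ln (real n) - T + pi)))"
        using mangoldt_nonneg[of n] by (intro mult_left_mono fejer_1_pair) auto
      moreover have "ln (real n) - T + pi = ln (real n) - (T - pi)" by simp
      ultimately show "mangoldt n / real n * (1 / (1 + (ln (real n) - T)\<^sup>2))
        \<le> 8 * (mangoldt n / real n * fejer 1 (ln (real n) - T)
            + mangoldt n / real n * fejer 1 (ln (real n) - (T - pi)))"
        by (simp only: distrib_left mult.left_commute)
    qed
    also have "\<dots> \<le> 8 * (105 + 105)"
      unfolding sum_distrib_left[symmetric] sum.distrib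
      using T pi_gt_zero by (intro mult_left_mono add_mono b A) (linarith | simp)+
    finally show ?thesis .
  qed
  then show ?thesis by blast
qed

text \<open>
  Suppose that no prime is near \<open>exp T\<close>. Then the von Mangoldt mass seen by a narrow Fejer kernel
  centred at \<open>T\<close> comes from its tails, where the kernel is of size \<open>1 / L\<close>, and from proper prime
  powers. Both are small, whereas the integers, to which the primes are compared, contribute at
  least \<open>1 / 12\<close>. The scale \<open>L\<close> is fixed first to make the tails small, then \<open>T\<close> is taken large.
\<close>

lemma eventually_prime_near:
  assumes \<epsilon>: "0 < \<epsilon>" "\<epsilon> \<le> 1"
  shows "eventually (\<lambda>T. \<exists>p. prime p \<and> \<bar>ln (real p) - T\<bar> < \<epsilon>) at_top"
proof -
  obtain C T0 where C: "\<And>T A. T \<ge> T0 \<Longrightarrow> finite A \<Longrightarrow>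
    (\<Sum>n\<in>A. mangoldt n / real n * (1 / (1 + (ln (real n) - T)\<^sup>2))) \<le> C"
    using mangoldt_cauchy_bound by auto
  have C0: "C \<ge> 0" using C[of T0 "{}"] by simp
  define D where "D = 4 * (1 + 1 / \<epsilon>\<^sup>2)"
  have D0: "D > 0" by (simp add: D_def add_pos_nonneg)
  \<comment> \<open>Three errors of size \<open>1 / 48\<close> stay below the main term \<open>1 / 12\<close>; the summand 1 ensures \<open>L \<ge> 1\<close>.\<close>
  define L where "L = 48 * D * C + 1"
  have L: "L \<ge> 1" using C0 D0 by (simp add: L_def)
  have DC: "D / L * C \<le> 1 / 48"
  proof -
    have "48 * (D * C) \<le> L" by (simp add: L_def)
    then show ?thesis using L by (simp add: field_simps)
  qed
  define r where "r T = 2 * (T + 1)\<^sup>2 * exp (3 / 2 - T / 2)" for T :: real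
  have "eventually (\<lambda>T. L * r T < 1 / 48) at_top"
  proof -
    have "((\<lambda>T. L * r T) \<longlongrightarrow> 0) at_top" unfolding r_def by real_asymp
    then show ?thesis by (rule order_tendstoD(2)) simp
  qed
  moreover have "eventually (\<lambda>T. 2 * L * exp (- T) < 1) at_top"
  proof -
    have "((\<lambda>T. 2 * L * exp (- T)) \<longlongrightarrow> 0) at_top" by real_asymp
    then show ?thesis by (rule order_tendstoD(2)) simp
  qed
  moreover have "eventually (\<lambda>T. fejer_error G L T 0 > - 1 / 48) at_top"
    using L by (intro order_tendstoD(1)[OF fejer_error_tendsto_0[OF S G]]) auto
  ultimately show ?thesis
    using eventually_ge_at_top[of T0] eventually_ge_at_top[of 1]
  proof eventually_elim
    case (elim T)
    show ?case
    proof (rule ccontr)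
      assume none: "\<not> ?case"
      let ?w = "\<lambda>n::nat. fejer L (ln (real n) - T)"
      let ?c = "\<lambda>n::nat. 1 / (1 + (ln (real n) - T)\<^sup>2)"
      have upper: "(\<Sum>n\<in>A'. mangoldt n / real n * ?w n) \<le> D / L * C + L * r T" if A': "finite A'" for A'
      proof -
        let ?F = "{n \<in> A'. \<epsilon> \<le> \<bar>ln (real n) - T\<bar>}" and ?N = "{n \<in> A'. \<bar>ln (real n) - T\<bar> < \<epsilon>}"
        have "(\<Sum>n\<in>?F. mangoldt n / real n * ?w n) \<le> (\<Sum>n\<in>?F. D / L * (mangoldt n / real n * ?c n))"
        proof (rule sum_mono)
          fix n assume n: "n \<in> ?F"
          define u where "u = ln (real n) - T"
          have u: "u \<noteq> 0" "\<epsilon> \<le> \<bar>u\<bar>" using n \<epsilon> by (auto simp: u_def)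
          have "\<epsilon>\<^sup>2 \<le> u\<^sup>2" using u \<epsilon> by (metis abs_le_square_iff abs_of_pos)
          then have "1 \<le> u\<^sup>2 / \<epsilon>\<^sup>2" using \<epsilon> by simp
          then have "4 * (1 + u\<^sup>2) \<le> D * u\<^sup>2" by (simp add: D_def algebra_simps)
          then have "4 / (L * u\<^sup>2) \<le> D / L * (1 / (1 + u\<^sup>2))"
            using u L mult_left_mono[of "4 * (1 + u\<^sup>2)" "D * u\<^sup>2" L]
            by (simp add: field_simps add_pos_nonneg)
          then have "?w n \<le> D / L * ?c n"
            using fejer_far[of L u] L u unfolding u_def by linarith
          then have "mangoldt n / real n * ?w n \<le> mangoldt n / real n * (D / L * ?c n)"
            using mangoldt_nonneg[of n] by (intro mult_left_mono) auto
          then show "mangoldt n / real n * ?w n \<le> D / L * (mangoldt n / real n * ?c n)"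
            by (simp only: mult.left_commute)
        qed
        also have "\<dots> \<le> D / L * C"
          unfolding sum_distrib_left[symmetric]
          using D0 L A' elim by (intro mult_left_mono C) auto
        finally have far: "(\<Sum>n\<in>?F. mangoldt n / real n * ?w n) \<le> D / L * C" .
        have "(\<Sum>n\<in>?N. mangoldt n / real n * ?w n) \<le> (\<Sum>n\<in>?N. L * (mangoldt n / real n))"
          using fejer_le[of L] L mangoldt_nonneg
          by (intro sum_mono) (subst mult.commute, intro mult_right_mono, auto)
        also have "\<dots> \<le> L * r T"
          unfolding sum_distrib_left[symmetric] r_def
        proof (intro mult_left_mono perfect_power_mass)
          fix n assume "n \<in> ?N"
          then show "\<bar>ln (real n) - T\<bar> < 1 \<and> \<not> prime n" using none \<epsilon> by auto
        qed (use A' L elim in auto)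
        finally have near: "(\<Sum>n\<in>?N. mangoldt n / real n * ?w n) \<le> L * r T" .
        have "A' = ?F \<union> ?N" by auto
        then have "(\<Sum>n\<in>A'. mangoldt n / real n * ?w n)
          = (\<Sum>n\<in>?F. mangoldt n / real n * ?w n) + (\<Sum>n\<in>?N. mangoldt n / real n * ?w n)"
          using A' by (subst \<open>A' = ?F \<union> ?N\<close>, intro sum.union_disjoint) auto
        then show ?thesis using far near by linarith
      qed
      obtain A where A: "finite A" "\<And>n. n \<in> A \<Longrightarrow> \<bar>ln (real n) - T\<bar> \<le> 1 / L"
        "(\<Sum>n\<in>A. 1 / real n) \<ge> 1 / (6 * L)"
        using harmonic_window[OF L, of T] elim by (metis less_imp_le)
      have "1 / 12 = 1 / (6 * L) * (L / 2)" using L by simp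
      also have "\<dots> \<le> (\<Sum>n\<in>A. 1 / real n) * (L / 2)" using A L by (intro mult_right_mono) auto
      also have "\<dots> \<le> (\<Sum>n\<in>A. 1 / real n * ?w n)"
        unfolding sum_distrib_right using L A(2) by (intro sum_mono mult_left_mono fejer_ge) auto
      finally have "1 / 12 \<le> (\<Sum>n\<in>A. 1 / real n * ?w n)" .
      moreover have "fejer_error G L T 0 + (\<Sum>n\<in>A. 1 / real n * ?w n) \<le> D / L * C + L * r T"
        using L by (intro mangoldt_fejer_lower A(1) upper) auto
      ultimately show False using elim DC by linarith
    qed
  qed
qed

end

theorem eventually_prime_between:
  fixes a b :: real
  assumes "0 < a" "a < b"
  shows "eventually (\<lambda>x. \<exists>p. prime p \<and> a * x < real p \<and> real p < b * x) at_top"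
proof -
  have "\<exists>G S. continuation G S"
    by (rule mangoldt_minus_zeta_extends) (auto simp: continuation_def)
  then obtain G S where "continuation G S" by blast
  then interpret continuation G S .
  define m where "m = (ln a + ln b) / 2"
  define \<epsilon> where "\<epsilon> = min 1 ((ln b - ln a) / 2)"
  have ln_ab: "ln a < ln b" using assms by simp
  have "filterlim (\<lambda>x. ln x + m) at_top at_top" by real_asymp
  moreover have "eventually (\<lambda>T. \<exists>p. prime p \<and> \<bar>ln (real p) - T\<bar> < \<epsilon>) at_top"
    using ln_ab by (intro eventually_prime_near) (auto simp: \<epsilon>_def)
  ultimately have "eventually (\<lambda>x. \<exists>p. prime p \<and> \<bar>ln (real p) - (ln x + m)\<bar> < \<epsilon>) at_top"
    by (rule eventually_compose_filterlim[rotated])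
  then show ?thesis
    using eventually_gt_at_top[of 0]
  proof eventually_elim
    case (elim x)
    then obtain p where p: "prime p" "\<bar>ln (real p) - (ln x + m)\<bar> < \<epsilon>" by blast
    have p0: "real p > 0" using p prime_gt_0_nat by simp
    have "\<epsilon> \<le> (ln b - ln a) / 2" unfolding \<epsilon>_def by (rule min.cobounded2)
    then have "ln a + ln x < ln (real p)" "ln (real p) < ln b + ln x"
      using p(2) unfolding m_def abs_less_iff by argo+
    then have "ln (a * x) < ln (real p)" "ln (real p) < ln (b * x)"
      using assms elim by (simp_all add: ln_mult)
    then have "a * x < real p" "real p < b * x"
      using assms elim p0 by simp_all
    with p show ?case by blast
  qed
qed

section \<open>The lower bound\<close>

text \<open>
  Take a prime \<open>q\<close> slightly below \<open>n\<close> and a prime \<open>p\<close> between \<open>2 sqrt n\<close> and \<open>3 sqrt n\<close>. The gap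
  between \<open>q\<close> and \<open>n\<close>, of order \<open>c n\<close>, absorbs the overhead \<open>2 p + 2\<close>.
\<close>

lemma eventually_g_ge:
  fixes c :: real
  assumes c: "0 < c" "c \<le> 1"
  shows "eventually (\<lambda>n. real (g n) \<ge> (1 - c) * (real n)\<^sup>2) sequentially"
proof -
  have "eventually (\<lambda>x. \<exists>q. prime q \<and> (1 - c / 4) * x < real q \<and> real q < (1 - c / 8) * x) at_top"
    using c by (intro eventually_prime_between) auto
  then have "eventually (\<lambda>n. \<exists>q. prime q \<and> (1 - c / 4) * real n < real q \<and> real q < (1 - c / 8) * real n) sequentially"
    by (rule eventually_compose_filterlim[OF _ filterlim_real_sequentially])
  moreover have "eventually (\<lambda>x. \<exists>p. prime p \<and> 2 * x < real p \<and> real p < 3 * x) at_top"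
    by (intro eventually_prime_between) auto
  then have "eventually (\<lambda>n. \<exists>p. prime p \<and> 2 * sqrt (real n) < real p \<and> real p < 3 * sqrt (real n)) sequentially"
    by (rule eventually_compose_filterlim)
      (rule filterlim_compose[OF sqrt_at_top filterlim_real_sequentially])
  moreover have "eventually (\<lambda>n. 6 * sqrt (real n) + 2 \<le> c / 8 * real n) sequentially"
    using c by real_asymp
  moreover have "eventually (\<lambda>n. real n \<le> c / 2 * (real n)\<^sup>2) sequentially"
    using c by real_asymp
  moreover have "eventually (\<lambda>n::nat. n \<ge> 1) sequentially" by (rule eventually_ge_at_top)
  ultimately show ?thesis
  proof eventually_elim
    case (elim n)
    obtain q where q: "prime q" "(1 - c / 4) * real n < real q" "real q < (1 - c / 8) * real n"
      using elim by blast
    obtain p where p: "prime p" "2 * sqrt (real n) < real p" "real p < 3 * sqrt (real n)"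
      using elim by blast
    have q1: "q \<ge> 1" using q prime_ge_1_nat by blast
    have qn: "real q \<le> real n"
    proof -
      have "(1 - c / 8) * real n \<le> 1 * real n" using c by (intro mult_right_mono) auto
      then show ?thesis using q by linarith
    qed
    have s1: "sqrt (real n) \<ge> 1" using elim by simp
    have "q \<le> p * (p - 1)"
    proof -
      have "real n = sqrt (real n) * sqrt (real n)" by simp
      also have "\<dots> \<le> real p * (real p - 1)"
      proof (rule mult_mono)
        show "sqrt (real n) \<le> real p" "sqrt (real n) \<le> real p - 1" using p(2) s1 by argo+
      qed auto
      also have "\<dots> = real (p * (p - 1))" using p prime_ge_1_nat by (simp add: of_nat_diff)
      finally show ?thesis using qn by (meson of_nat_le_iff order.trans)
    qed
    moreover have "q + 2 * p + 2 \<le> n"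
    proof -
      have "real q + 2 * real p + 2 \<le> real n"
        using q(3) p(3) elim unfolding left_diff_distrib by argo
      then have "real (q + 2 * p + 2) \<le> real n" by simp
      then show ?thesis by (simp only: of_nat_le_iff)
    qed
    ultimately have "q * (q - 1) \<le> g n" using q p by (intro prime_system_size)
    then have "real (q * (q - 1)) \<le> real (g n)" by (simp only: of_nat_le_iff)
    then have "(real q)\<^sup>2 - real q \<le> real (g n)"
      using q1 by (simp add: of_nat_diff power2_eq_square algebra_simps)
    moreover have "((1 - c / 4) * real n)\<^sup>2 \<le> (real q)\<^sup>2"
      using q c by (intro power_mono) auto
    moreover have "(1 - c / 2) * (real n)\<^sup>2 \<le> ((1 - c / 4) * real n)\<^sup>2"
      unfolding power_mult_distrib by (intro mult_right_mono) (auto simp: power2_eq_square algebra_simps)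
    moreover have "(1 - c / 2) * (real n)\<^sup>2 - c / 2 * (real n)\<^sup>2 = (1 - c) * (real n)\<^sup>2"
      by (simp add: algebra_simps)
    ultimately show ?case using qn elim by linarith
  qed
qed

theorem mainTheorem10:
  shows "\<exists>e :: nat \<Rightarrow> real. e \<in> o(\<lambda>n. (real n)\<^sup>2) \<and>
           (\<forall>n\<ge>2. real (g n) \<ge> (real n)\<^sup>2 - e n)"
proof (intro exI conjI allI impI)
  \<comment> \<open>The cut-off at 0 is for those \<open>n\<close>, if any, at which \<open>g n\<close> is larger than \<open>n\<close> squared.\<close>
  let ?e = "\<lambda>n. max 0 ((real n)\<^sup>2 - real (g n))"
  show "(real n)\<^sup>2 - ?e n \<le> real (g n)" for n by simp
  show "?e \<in> o(\<lambda>n. (real n)\<^sup>2)"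
  proof (rule landau_o.smallI)
    fix c :: real assume c: "c > 0"
    define c' where "c' = min c 1"
    have "eventually (\<lambda>n. real (g n) \<ge> (1 - c') * (real n)\<^sup>2) sequentially"
      using c by (intro eventually_g_ge) (auto simp: c'_def)
    then show "eventually (\<lambda>n. norm (?e n) \<le> c * norm ((real n)\<^sup>2)) sequentially"
    proof eventually_elim
      case (elim n)
      have "c' * (real n)\<^sup>2 \<le> c * (real n)\<^sup>2" by (intro mult_right_mono) (auto simp: c'_def)
      moreover have "0 \<le> c * (real n)\<^sup>2" using c by simp
      ultimately show ?case using elim unfolding left_diff_distrib by auto
    qed
  qed
qed

end
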